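(* Let $X$ be a complex Banach space, $p\in(1,\infty)$, $r>0$, $A$ a generator of a strongly continuous semigroup on $X$, $a\in W^{1,p}(\mathbb{R}_+,\mathbb{C})$, and $\mu:[-r,0]\to\mathcal{L}(X)$ of bounded variation, continuous at $0$, with $|\mu|([-\varepsilon,0])\to0$ as $\varepsilon\to0$; $L\varphi=\int_{-r}^0d\mu(\theta)\varphi(\theta)$ for $\varphi\in W^{1,p}([-r,0],X)$. On $\mathcal{X}_0=X\times L^p(\mathbb{R}_+,X)$ let $\mathcal{A}^{\delta_0}(x,f)=(Ax+f(0),\,a(\cdot)Ax+f')$ and $\mathcal{A}_0(x,f)=(Ax+f(0),\,f')$, both with domain $D(A)\times W^{1,p}(\mathbb{R}_+,X)$. On $\mathcal{X}=\mathcal{X}_0\times L^p([-r,0],X)$ let $\mathfrak{A}_L(x,f,\varphi)=(Ax+f(0)+L\varphi,\,a(\cdot)Ax+f',\,\varphi')$ with $D(\mathfrak{A}_L)=\{(x,f,\varphi)\in D(A)\times W^{1,p}(\mathbb{R}_+,X)\times W^{1,p}([-r,0],X):\varphi(0)=x\}$. Then for $\lambda\in\mathbb{C}_0\cap\rho(\mathcal{A}^{\delta_0})\cap\rho(\mathcal{A}_0)$, $$\lambda\in\rho(\mathfrak{A}_L)\iff\lambda\in\rho\big((1+\hat a(\lambda))A+Le_\lambda\big).$$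
   Context: $\mathbb{C}_0=\{\lambda\in\mathbb{C}:\operatorname{Re}\lambda>0\}$. $\hat a(\lambda)=\int_0^\infty e^{-\lambda t}a(t)\,dt$ is the Laplace transform of $a$. $e_\lambda x$ is the function $\theta\mapsto e^{\lambda\theta}x$ on $[-r,0]$, so $Le_\lambda x=\int_{-r}^0e^{\lambda\theta}d\mu(\theta)x$; the operator $(1+\hat a(\lambda))A+Le_\lambda$ has domain $D(A)$. *)

theory Defs
  imports "HOL-Analysis.Analysis"
begin

text \<open>A complex Banach space is modelled as a real Banach space (type class banach)
together with a complex scalar multiplication sm extending the real one and
satisfying absolute homogeneity of the norm.\<close>

definition complex_banach_smul :: "(complex \<Rightarrow> 'a::banach \<Rightarrow> 'a) \<Rightarrow> bool" where
  "complex_banach_smul sm \<longleftrightarrow>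
     (\<forall>c x y. sm c (x + y) = sm c x + sm c y) \<and>
     (\<forall>c d x. sm (c + d) x = sm c x + sm d x) \<and>
     (\<forall>c d x. sm (c * d) x = sm c (sm d x)) \<and>
     (\<forall>s x. sm (complex_of_real s) x = s *\<^sub>R x) \<and>
     (\<forall>c x. norm (sm c x) = cmod c * norm x)"

definition complex_linear :: "(complex \<Rightarrow> 'a::banach \<Rightarrow> 'a) \<Rightarrow> ('a \<Rightarrow> 'a) \<Rightarrow> bool" where
  "complex_linear sm T \<longleftrightarrow> linear T \<and> (\<forall>c x. T (sm c x) = sm c (T x))"

definition C0_semigroup :: "(complex \<Rightarrow> 'a::banach \<Rightarrow> 'a) \<Rightarrow> (real \<Rightarrow> 'a \<Rightarrow> 'a) \<Rightarrow> bool" where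
  "C0_semigroup sm T \<longleftrightarrow>
     (\<forall>t\<ge>0. bounded_linear (T t) \<and> complex_linear sm (T t)) \<and>
     T 0 = id \<and>
     (\<forall>s\<ge>0. \<forall>t\<ge>0. T (s + t) = T s \<circ> T t) \<and>
     (\<forall>x. ((\<lambda>t. T t x) \<longlongrightarrow> x) (at_right 0))"

definition is_C0_generator :: "(complex \<Rightarrow> 'a::banach \<Rightarrow> 'a) \<Rightarrow> 'a set \<Rightarrow> ('a \<Rightarrow> 'a) \<Rightarrow> bool" where
  "is_C0_generator sm D A \<longleftrightarrow>
     (\<exists>T. C0_semigroup sm T \<and>
          D = {x. \<exists>y. ((\<lambda>h. (T h x - x) /\<^sub>R h) \<longlongrightarrow> y) (at_right 0)} \<and>
          (\<forall>x\<in>D. ((\<lambda>h. (T h x - x) /\<^sub>R h) \<longlongrightarrow> A x) (at_right 0)))"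

definition simple_fun_leb :: "(real \<Rightarrow> 'b::real_normed_vector) \<Rightarrow> bool" where
  "simple_fun_leb s \<longleftrightarrow> finite (range s) \<and> (\<forall>c. s -` {c} \<in> sets lebesgue)"

definition strongly_measurable_on :: "real set \<Rightarrow> (real \<Rightarrow> 'b::real_normed_vector) \<Rightarrow> bool" where
  "strongly_measurable_on S f \<longleftrightarrow>
     (\<exists>s. (\<forall>n. simple_fun_leb (s n)) \<and>
          (AE t in lebesgue. t \<in> S \<longrightarrow> (\<lambda>n. s n t) \<longlonglongrightarrow> f t))"

definition Lp :: "real \<Rightarrow> real set \<Rightarrow> (real \<Rightarrow> 'b::real_normed_vector) \<Rightarrow> bool" where
  "Lp p S f \<longleftrightarrow> strongly_measurable_on S f \<and>
     (\<integral>\<^sup>+ t\<in>S. ennreal (norm (f t) powr p) \<partial>lebesgue) < \<infinity>"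

definition Lp_norm :: "real \<Rightarrow> real set \<Rightarrow> (real \<Rightarrow> 'b::real_normed_vector) \<Rightarrow> real" where
  "Lp_norm p S f = enn2real (\<integral>\<^sup>+ t\<in>S. ennreal (norm (f t) powr p) \<partial>lebesgue) powr (1 / p)"

text \<open>f is (the continuous representative of) an element of W^{1,p}(S) with derivative g,
  where S is an interval with left endpoint a.\<close>
definition W1p :: "real \<Rightarrow> real \<Rightarrow> real set \<Rightarrow> (real \<Rightarrow> 'b::real_normed_vector) \<Rightarrow> (real \<Rightarrow> 'b) \<Rightarrow> bool" where
  "W1p p a S f g \<longleftrightarrow> Lp p S f \<and> Lp p S g \<and> (\<forall>t\<in>S. (g has_integral (f t - f a)) {a..t})"

definition partition_var :: "(real \<Rightarrow> 'c::real_normed_vector) \<Rightarrow> real list \<Rightarrow> real" where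
  "partition_var f xs = (\<Sum>i<length xs - 1. norm (f (xs ! Suc i) - f (xs ! i)))"

definition bounded_variation_on :: "(real \<Rightarrow> 'c::real_normed_vector) \<Rightarrow> real \<Rightarrow> real \<Rightarrow> bool" where
  "bounded_variation_on f a b \<longleftrightarrow>
     bdd_above {partition_var f xs | xs. sorted xs \<and> set xs \<subseteq> {a..b}}"

definition total_variation :: "(real \<Rightarrow> 'c::real_normed_vector) \<Rightarrow> real \<Rightarrow> real \<Rightarrow> real" where
  "total_variation f a b = Sup {partition_var f xs | xs. sorted xs \<and> set xs \<subseteq> {a..b}}"

definition has_RS_integral ::
  "(real \<Rightarrow> 'a::real_normed_vector \<Rightarrow>\<^sub>L 'a) \<Rightarrow> (real \<Rightarrow> 'a) \<Rightarrow> real \<Rightarrow> real \<Rightarrow> 'a \<Rightarrow> bool" where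
  "has_RS_integral \<mu> \<phi> a b I \<longleftrightarrow>
     (\<forall>\<epsilon>>0. \<exists>\<delta>>0. \<forall>xs ts.
        xs \<noteq> [] \<and> hd xs = a \<and> last xs = b \<and> sorted xs \<and>
        (\<forall>i<length xs - 1. xs ! Suc i - xs ! i < \<delta>) \<and>
        length ts = length xs - 1 \<and>
        (\<forall>i<length ts. xs ! i \<le> ts ! i \<and> ts ! i \<le> xs ! Suc i) \<longrightarrow>
        norm ((\<Sum>i<length ts. blinfun_apply (\<mu> (xs ! Suc i) - \<mu> (xs ! i)) (\<phi> (ts ! i))) - I) < \<epsilon>)"

definition delay_op :: "(real \<Rightarrow> 'a::real_normed_vector \<Rightarrow>\<^sub>L 'a) \<Rightarrow> real \<Rightarrow> (real \<Rightarrow> 'a) \<Rightarrow> 'a" where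
  "delay_op \<mu> r \<phi> = (THE I. has_RS_integral \<mu> \<phi> (- r) 0 I)"

definition exp_fun :: "(complex \<Rightarrow> 'a \<Rightarrow> 'a) \<Rightarrow> complex \<Rightarrow> 'a \<Rightarrow> real \<Rightarrow> 'a" where
  "exp_fun sm lam x = (\<lambda>\<theta>. sm (exp (lam * complex_of_real \<theta>)) x)"

definition laplace :: "(real \<Rightarrow> complex) \<Rightarrow> complex \<Rightarrow> complex" where
  "laplace a lam = (LINT t:{0..}|lborel. exp (- lam * complex_of_real t) * a t)"

definition in_resolvent_X :: "(complex \<Rightarrow> 'a::banach \<Rightarrow> 'a) \<Rightarrow> 'a set \<Rightarrow> ('a \<Rightarrow> 'a) \<Rightarrow> complex \<Rightarrow> bool" where
  "in_resolvent_X sm D B lam \<longleftrightarrow>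
     (\<forall>y. \<exists>x\<in>D. sm lam x - B x = y) \<and>
     (\<exists>C. \<forall>x\<in>D. norm x \<le> C * norm (sm lam x - B x))"

text \<open>Same on X0 = X x L^p(R_+,X); the operator is given by its graph G (pairs (u, Bu)),
  elements of L^p are identified when their difference has zero norm.\<close>
definition in_resolvent_X0 :: "(complex \<Rightarrow> 'a::banach \<Rightarrow> 'a) \<Rightarrow> real \<Rightarrow>
    ((('a \<times> (real \<Rightarrow> 'a)) \<times> ('a \<times> (real \<Rightarrow> 'a))) set) \<Rightarrow> complex \<Rightarrow> bool" where
  "in_resolvent_X0 sm p G lam \<longleftrightarrow>
     (\<forall>y f. Lp p {0..} f \<longrightarrow>
        (\<exists>((x, h), (v, k))\<in>G. sm lam x - v = y \<and>
            Lp_norm p {0..} (\<lambda>t. sm lam (h t) - k t - f t) = 0)) \<and>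
     (\<exists>C. \<forall>((x, h), (v, k))\<in>G.
        norm x + Lp_norm p {0..} h \<le>
          C * (norm (sm lam x - v) + Lp_norm p {0..} (\<lambda>t. sm lam (h t) - k t)))"

definition in_resolvent_XX :: "(complex \<Rightarrow> 'a::banach \<Rightarrow> 'a) \<Rightarrow> real \<Rightarrow> real \<Rightarrow>
    ((('a \<times> (real \<Rightarrow> 'a) \<times> (real \<Rightarrow> 'a)) \<times> ('a \<times> (real \<Rightarrow> 'a) \<times> (real \<Rightarrow> 'a))) set) \<Rightarrow>
    complex \<Rightarrow> bool" where
  "in_resolvent_XX sm p r G lam \<longleftrightarrow>
     (\<forall>y f \<psi>. Lp p {0..} f \<longrightarrow> Lp p {-r..0} \<psi> \<longrightarrow>
        (\<exists>((x, h, \<phi>), (v, k, w))\<in>G. sm lam x - v = y \<and>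
            Lp_norm p {0..} (\<lambda>t. sm lam (h t) - k t - f t) = 0 \<and>
            Lp_norm p {-r..0} (\<lambda>t. sm lam (\<phi> t) - w t - \<psi> t) = 0)) \<and>
     (\<exists>C. \<forall>((x, h, \<phi>), (v, k, w))\<in>G.
        norm x + Lp_norm p {0..} h + Lp_norm p {-r..0} \<phi> \<le>
          C * (norm (sm lam x - v) + Lp_norm p {0..} (\<lambda>t. sm lam (h t) - k t)
               + Lp_norm p {-r..0} (\<lambda>t. sm lam (\<phi> t) - w t)))"

definition A_delta0 :: "(complex \<Rightarrow> 'a::banach \<Rightarrow> 'a) \<Rightarrow> real \<Rightarrow> 'a set \<Rightarrow> ('a \<Rightarrow> 'a) \<Rightarrow> (real \<Rightarrow> complex)
    \<Rightarrow> (('a \<times> (real \<Rightarrow> 'a)) \<times> ('a \<times> (real \<Rightarrow> 'a))) set" where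
  "A_delta0 sm p D A a =
     {((x, f), (A x + f 0, \<lambda>t. sm (a t) (A x) + g t)) | x f g. x \<in> D \<and> W1p p 0 {0..} f g}"

definition A_zero :: "real \<Rightarrow> 'a set \<Rightarrow> ('a::banach \<Rightarrow> 'a)
    \<Rightarrow> (('a \<times> (real \<Rightarrow> 'a)) \<times> ('a \<times> (real \<Rightarrow> 'a))) set" where
  "A_zero p D A =
     {((x, f), (A x + f 0, g)) | x f g. x \<in> D \<and> W1p p 0 {0..} f g}"

definition frakA_L :: "(complex \<Rightarrow> 'a::banach \<Rightarrow> 'a) \<Rightarrow> real \<Rightarrow> real \<Rightarrow> 'a set \<Rightarrow> ('a \<Rightarrow> 'a)
    \<Rightarrow> (real \<Rightarrow> complex) \<Rightarrow> (real \<Rightarrow> 'a \<Rightarrow>\<^sub>L 'a)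
    \<Rightarrow> (('a \<times> (real \<Rightarrow> 'a) \<times> (real \<Rightarrow> 'a)) \<times> ('a \<times> (real \<Rightarrow> 'a) \<times> (real \<Rightarrow> 'a))) set" where
  "frakA_L sm p r D A a \<mu> =
     {((x, f, \<phi>), (A x + f 0 + delay_op \<mu> r \<phi>, \<lambda>t. sm (a t) (A x) + g t, \<psi>)) | x f g \<phi> \<psi>.
        x \<in> D \<and> W1p p 0 {0..} f g \<and> W1p p (- r) {-r..0} \<phi> \<psi> \<and> \<phi> 0 = x}"

end

theory Submission
  imports Defs
begin

text \<open>
  Solving the last two components of \<open>(lam - \<AA>\<^sub>L)(x, h, \<phi>) = (y, f, \<eta>)\<close> determines \<open>h\<close> and \<open>\<phi>\<close>
  from \<open>x\<close>: \<open>\<phi>\<close> is \<open>\<theta> \<mapsto> exp(lam \<theta>) x\<close> plus a term bounded by the norm of \<open>\<eta>\<close>, and integrability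
  of \<open>h\<close> at infinity forces \<open>h(0)\<close> to be the Laplace transform of \<open>a(\<cdot>)Ax + f\<close> at \<open>lam\<close>; both are
  instances of one variation-of-constants estimate between the endpoints of an interval.
  Inserting this into the first component leaves \<open>(lam - (1 + laplace a lam)A - L exp(lam \<cdot>)) x\<close>
  on the left and data bounded by the right-hand side. Solvability of the second and third
  component comes from \<open>lam \<in> \<rho>(\<A>\<^sub>0)\<close>; the norm of \<open>h\<close> is bounded by the resolvent estimate for
  \<open>lam \<in> \<rho>(\<A>\<^sup>\<delta>\<^sup>0)\<close>, with \<open>L \<phi>\<close> treated as part of the data.
\<close>

section \<open>Strong measurability\<close>

lemma simple_fun_leb_compose2:
  fixes H :: "'b::real_normed_vector \<Rightarrow> 'c::real_normed_vector \<Rightarrow> 'd::real_normed_vector"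
  assumes "simple_fun_leb s" and "simple_fun_leb s'"
  shows "simple_fun_leb (\<lambda>t. H (s t) (s' t))"
  unfolding simple_fun_leb_def
proof (intro conjI allI)
  have finite: "finite (range s \<times> range s')"
    using assms by (auto simp: simple_fun_leb_def)
  have "range (\<lambda>t. H (s t) (s' t)) \<subseteq> (\<lambda>(u, v). H u v) ` (range s \<times> range s')"
    by auto
  then show "finite (range (\<lambda>t. H (s t) (s' t)))"
    using finite finite_subset by blast
  fix c
  have "(\<lambda>t. H (s t) (s' t)) -` {c} =
      (\<Union>(u, v) \<in> {(u, v) \<in> range s \<times> range s'. H u v = c}. s -` {u} \<inter> s' -` {v})"
    by auto
  also have "\<dots> \<in> sets lebesgue"
    using assms by (intro sets.finite_UN finite_subset[OF _ finite]) (auto simp: simple_fun_leb_def)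
  finally show "(\<lambda>t. H (s t) (s' t)) -` {c} \<in> sets lebesgue" .
qed

lemma simple_fun_leb_translate:
  assumes "simple_fun_leb s"
  shows "simple_fun_leb (\<lambda>t. s (t + c))"
  unfolding simple_fun_leb_def
proof (intro conjI allI)
  show "finite (range (\<lambda>t. s (t + c)))"
    using assms by (auto simp: simple_fun_leb_def elim: finite_subset[rotated])
  fix v
  have "(\<lambda>t. s (t + c)) -` {v} = (+) (- c) ` (s -` {v})"
    by (auto simp: image_iff intro!: bexI[of _ "_ + c"])
  then show "(\<lambda>t. s (t + c)) -` {v} \<in> sets lebesgue"
    using assms by (simp only: simple_fun_leb_def lebesgue_sets_translation)
qed

lemma simple_fun_leb_iff_simple_function: "simple_fun_leb s \<longleftrightarrow> simple_function lebesgue s"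
proof
  assume simple: "simple_function lebesgue s"
  have "s -` {c} \<in> sets lebesgue" for c
  proof (cases "c \<in> range s")
    case True
    then show ?thesis using simple by (auto simp: simple_function_def)
  next
    case False
    then have "s -` {c} = {}" by auto
    then show ?thesis by simp
  qed
  then show "simple_fun_leb s"
    using simple by (simp add: simple_fun_leb_def simple_function_def)
qed (simp add: simple_fun_leb_def simple_function_def)

lemma strongly_measurable_onE:
  assumes "strongly_measurable_on S f"
  obtains s where "\<And>n. simple_fun_leb (s n)"
    and "AE t in lebesgue. t \<in> S \<longrightarrow> (\<lambda>n. s n t) \<longlonglongrightarrow> f t"
  using assms by (auto simp: strongly_measurable_on_def)

lemma strongly_measurable_onI:
  assumes "\<And>n. simple_fun_leb (s n)"
    and "AE t in lebesgue. t \<in> S \<longrightarrow> (\<lambda>n. s n t) \<longlonglongrightarrow> f t"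
  shows "strongly_measurable_on S f"
  using assms by (auto simp: strongly_measurable_on_def)

lemma strongly_measurable_on_subset:
  assumes "strongly_measurable_on S f" and "S' \<subseteq> S"
  shows "strongly_measurable_on S' f"
proof -
  obtain s where s: "\<And>n. simple_fun_leb (s n)"
      and lim: "AE t in lebesgue. t \<in> S \<longrightarrow> (\<lambda>n. s n t) \<longlonglongrightarrow> f t"
    using strongly_measurable_onE[OF assms(1)] by blast
  have "AE t in lebesgue. t \<in> S' \<longrightarrow> (\<lambda>n. s n t) \<longlonglongrightarrow> f t"
    using lim by eventually_elim (use assms(2) in auto)
  with s show ?thesis
    by (rule strongly_measurable_onI)
qed

lemma strongly_measurable_on_compose2:
  fixes H :: "'b::real_normed_vector \<Rightarrow> 'c::real_normed_vector \<Rightarrow> 'd::real_normed_vector"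
  assumes f: "strongly_measurable_on S f" and g: "strongly_measurable_on S g"
    and H: "continuous_on UNIV (\<lambda>(x, y). H x y)"
  shows "strongly_measurable_on S (\<lambda>t. H (f t) (g t))"
proof -
  obtain s where s: "\<And>n. simple_fun_leb (s n)"
      and lim_s: "AE t in lebesgue. t \<in> S \<longrightarrow> (\<lambda>n. s n t) \<longlonglongrightarrow> f t"
    using strongly_measurable_onE[OF f] by blast
  obtain s' where s': "\<And>n. simple_fun_leb (s' n)"
      and lim_s': "AE t in lebesgue. t \<in> S \<longrightarrow> (\<lambda>n. s' n t) \<longlonglongrightarrow> g t"
    using strongly_measurable_onE[OF g] by blast
  have lim: "(\<lambda>n. H (u n) (v n)) \<longlonglongrightarrow> H x y" if "u \<longlonglongrightarrow> x" "v \<longlonglongrightarrow> y" for u v x y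
    using continuous_on_tendsto_compose[OF H tendsto_Pair[OF that]] by simp
  have "AE t in lebesgue. t \<in> S \<longrightarrow> (\<lambda>n. H (s n t) (s' n t)) \<longlonglongrightarrow> H (f t) (g t)"
    using lim_s lim_s' by eventually_elim (auto intro: lim)
  then show ?thesis
    using simple_fun_leb_compose2[OF s s'] by (rule strongly_measurable_onI[rotated])
qed

lemma strongly_measurable_on_compose:
  fixes H :: "'b::real_normed_vector \<Rightarrow> 'd::real_normed_vector"
  assumes "strongly_measurable_on S f" and "continuous_on UNIV H"
  shows "strongly_measurable_on S (\<lambda>t. H (f t))"
proof -
  have "continuous_on UNIV (\<lambda>(x, y::'b). H x)"
    unfolding split_def by (rule continuous_on_compose2[OF assms(2)]) (auto intro: continuous_intros)
  from strongly_measurable_on_compose2[OF assms(1,1) this] show ?thesis .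
qed

lemma AE_lebesgue_translate:
  fixes c :: real
  assumes "AE t in lebesgue. P t"
  shows "AE t in lebesgue. P (t + c)"
proof -
  have "negligible {t. \<not> P t}"
    using assms by (simp add: completion.AE_iff_null_sets negligible_iff_null_sets)
  then have "negligible ((+) (- c) ` {t. \<not> P t})"
    by (rule negligible_translation)
  also have "(+) (- c) ` {t. \<not> P t} = {t. \<not> P (t + c)}"
    by (auto simp: image_iff intro!: exI[of _ "_ + c"])
  finally show ?thesis
    by (simp add: completion.AE_iff_null_sets negligible_iff_null_sets)
qed

lemma strongly_measurable_on_translate:
  assumes "strongly_measurable_on S f"
  shows "strongly_measurable_on {t. t + c \<in> S} (\<lambda>t. f (t + c))"
proof -
  obtain s where s: "\<And>n. simple_fun_leb (s n)"
      and lim: "AE t in lebesgue. t \<in> S \<longrightarrow> (\<lambda>n. s n t) \<longlonglongrightarrow> f t"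
    using strongly_measurable_onE[OF assms] by blast
  have "AE t in lebesgue. t \<in> {t. t + c \<in> S} \<longrightarrow> (\<lambda>n. s n (t + c)) \<longlonglongrightarrow> f (t + c)"
    using AE_lebesgue_translate[OF lim, of c] by simp
  then show ?thesis
    using simple_fun_leb_translate[OF s] by (rule strongly_measurable_onI[rotated])
qed

lemma strongly_measurable_on_extend_by_zero:
  assumes "strongly_measurable_on S f" and S: "S \<in> sets lebesgue"
  shows "strongly_measurable_on S' (\<lambda>t. if t \<in> S then f t else 0)"
proof -
  obtain s where s: "\<And>n. simple_fun_leb (s n)"
      and lim: "AE t in lebesgue. t \<in> S \<longrightarrow> (\<lambda>n. s n t) \<longlonglongrightarrow> f t"
    using strongly_measurable_onE[OF assms(1)] by blast
  have "simple_fun_leb (indicator S :: real \<Rightarrow> real)"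
    unfolding simple_fun_leb_iff_simple_function using S by (intro simple_function_indicator) auto
  then have "simple_fun_leb (\<lambda>t. indicat_real S t *\<^sub>R s n t)" for n
    using s by (rule simple_fun_leb_compose2)
  moreover have "AE t in lebesgue. t \<in> S' \<longrightarrow>
      (\<lambda>n. indicat_real S t *\<^sub>R s n t) \<longlonglongrightarrow> (if t \<in> S then f t else 0)"
    using lim by eventually_elim auto
  ultimately show ?thesis
    by (rule strongly_measurable_onI)
qed

lemma strongly_measurable_on_iff_set_borel_measurable:
  fixes f :: "real \<Rightarrow> 'b::euclidean_space"
  assumes S: "S \<in> sets lebesgue"
  shows "strongly_measurable_on S f \<longleftrightarrow> set_borel_measurable lebesgue S f"
proof
  assume f: "strongly_measurable_on S f"
  obtain s where s: "\<And>n. simple_fun_leb (s n)"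
      and lim: "AE t in lebesgue. t \<in> S \<longrightarrow> (\<lambda>n. s n t) \<longlonglongrightarrow> f t"
    using strongly_measurable_onE[OF f] by blast
  have [measurable]: "s n \<in> borel_measurable lebesgue" for n
    using s by (simp add: simple_fun_leb_iff_simple_function borel_measurable_simple_function)
  have "(\<lambda>t. lim (\<lambda>n. indicator S t *\<^sub>R s n t)) \<in> borel_measurable lebesgue"
    using S by measurable
  moreover have "AE t in lebesgue. lim (\<lambda>n. indicator S t *\<^sub>R s n t) = indicator S t *\<^sub>R f t"
    using lim
  proof eventually_elim
    case (elim t)
    then have "(\<lambda>n. indicator S t *\<^sub>R s n t) \<longlonglongrightarrow> indicator S t *\<^sub>R f t"
      by (cases "t \<in> S") auto
    then show ?case by (rule limI)
  qed
  ultimately show "set_borel_measurable lebesgue S f"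
    unfolding set_borel_measurable_def by (rule borel_measurable_AE)
next
  assume "set_borel_measurable lebesgue S f"
  then obtain s where "\<And>n. simple_function lebesgue (s n)"
      "\<And>t. (\<lambda>n. s n t) \<longlonglongrightarrow> indicator S t *\<^sub>R f t"
    unfolding set_borel_measurable_def
    using borel_measurable_implies_sequence_metric[of "\<lambda>t. indicator S t *\<^sub>R f t" lebesgue 0] by auto
  then show "strongly_measurable_on S f"
    by (intro strongly_measurable_onI[of s] AE_I2)
      (auto simp: simple_fun_leb_iff_simple_function dest: meta_spec split: split_indicator_asm)
qed

section \<open>The spaces \<open>L\<^sup>p\<close>\<close>

lemma Lp_iff_set_integrable:
  fixes f :: "real \<Rightarrow> 'b::real_normed_vector"
  assumes S: "S \<in> sets lebesgue"
  shows "Lp p S f \<longleftrightarrow>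
    strongly_measurable_on S f \<and> set_integrable lebesgue S (\<lambda>t. norm (f t) powr p)"
proof -
  have nn_integral_norm: "(\<integral>\<^sup>+ t. ennreal (norm (indicator S t *\<^sub>R norm (f t) powr p)) \<partial>lebesgue) =
      (\<integral>\<^sup>+ t\<in>S. ennreal (norm (f t) powr p) \<partial>lebesgue)"
    by (intro nn_integral_cong) (auto split: split_indicator)
  have "set_borel_measurable lebesgue S (\<lambda>t. norm (f t) powr p)" if "strongly_measurable_on S f"
  proof -
    have "strongly_measurable_on S (\<lambda>t. norm (f t))"
      using that by (rule strongly_measurable_on_compose) (intro continuous_intros)
    then have [measurable]: "(\<lambda>t. indicator S t *\<^sub>R norm (f t)) \<in> borel_measurable lebesgue"
      using S by (simp add: strongly_measurable_on_iff_set_borel_measurable set_borel_measurable_def)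
    have "(\<lambda>t. indicator S t *\<^sub>R (indicator S t *\<^sub>R norm (f t)) powr p) \<in> borel_measurable lebesgue"
      using S by measurable
    also have "(\<lambda>t. indicator S t *\<^sub>R (indicator S t *\<^sub>R norm (f t)) powr p) =
        (\<lambda>t. indicator S t *\<^sub>R norm (f t) powr p)"
      by (auto split: split_indicator)
    finally show ?thesis
      by (simp add: set_borel_measurable_def)
  qed
  then show ?thesis
    unfolding Lp_def set_integrable_def integrable_iff_bounded nn_integral_norm
      set_borel_measurable_def by blast
qed

lemma LpI:
  fixes f :: "real \<Rightarrow> 'b::real_normed_vector"
  assumes S: "S \<in> sets lebesgue" and f: "strongly_measurable_on S f"
    and G: "set_integrable lebesgue S G" and dominated: "\<And>t. t \<in> S \<Longrightarrow> norm (f t) powr p \<le> G t"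
  shows "Lp p S f"
proof -
  have "(\<integral>\<^sup>+ t\<in>S. ennreal (norm (f t) powr p) \<partial>lebesgue) \<le>
      (\<integral>\<^sup>+ t. ennreal (norm (indicator S t *\<^sub>R G t)) \<partial>lebesgue)"
    using dominated by (intro nn_integral_mono) (force split: split_indicator intro: ennreal_leI)
  also have "\<dots> < \<infinity>"
    using G by (simp add: set_integrable_def integrable_iff_bounded)
  finally show ?thesis
    using f by (simp add: Lp_def)
qed

lemma Lp_subset:
  fixes f :: "real \<Rightarrow> 'b::real_normed_vector"
  assumes f: "Lp p S f" and "S' \<subseteq> S" and S: "S \<in> sets lebesgue" "S' \<in> sets lebesgue"
  shows "Lp p S' f"
  using f assms(2) unfolding Lp_iff_set_integrable[OF S(1)] Lp_iff_set_integrable[OF S(2)]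
  by (auto intro: strongly_measurable_on_subset set_integrable_subset[OF _ S(2)])

lemma Lp_compose:
  fixes f :: "real \<Rightarrow> 'b::real_normed_vector" and H :: "'b \<Rightarrow> 'c::real_normed_vector"
  assumes p: "0 \<le> p" and S: "S \<in> sets lebesgue" and f: "Lp p S f"
    and H: "continuous_on UNIV H" "\<And>x. norm (H x) \<le> K * norm x"
  shows "Lp p S (\<lambda>t. H (f t))"
proof (rule LpI[OF S])
  show "strongly_measurable_on S (\<lambda>t. H (f t))"
    using f H(1) by (auto simp: Lp_def intro: strongly_measurable_on_compose)
  show "set_integrable lebesgue S (\<lambda>t. \<bar>K\<bar> powr p * norm (f t) powr p)"
    using f S by (simp add: Lp_iff_set_integrable)
  fix t
  have "norm (H (f t)) \<le> \<bar>K\<bar> * norm (f t)"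
    by (rule order_trans[OF H(2)]) (intro mult_right_mono, auto)
  then have "norm (H (f t)) powr p \<le> (\<bar>K\<bar> * norm (f t)) powr p"
    using p by (intro powr_mono2) auto
  then show "norm (H (f t)) powr p \<le> \<bar>K\<bar> powr p * norm (f t) powr p"
    by (simp add: powr_mult)
qed

lemma norm_add_powr_le:
  fixes x y :: "'b::real_normed_vector"
  assumes "0 \<le> p"
  shows "norm (x + y) powr p \<le> 2 powr p * (norm x powr p + norm y powr p)"
proof -
  have "norm (x + y) powr p \<le> (2 * max (norm x) (norm y)) powr p"
    using norm_triangle_ineq[of x y] assms by (intro powr_mono2) (auto simp: max_def)
  also have "\<dots> = 2 powr p * max (norm x) (norm y) powr p"
    by (simp add: powr_mult)
  also have "\<dots> \<le> 2 powr p * (norm x powr p + norm y powr p)"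
    by (intro mult_left_mono) (auto simp: max_def)
  finally show ?thesis .
qed

lemma Lp_add:
  fixes f g :: "real \<Rightarrow> 'b::real_normed_vector"
  assumes p: "0 \<le> p" and S: "S \<in> sets lebesgue" and f: "Lp p S f" and g: "Lp p S g"
  shows "Lp p S (\<lambda>t. f t + g t)"
proof (rule LpI[OF S])
  show "strongly_measurable_on S (\<lambda>t. f t + g t)"
    using f g by (intro strongly_measurable_on_compose2[where H = "(+)"])
      (auto simp: Lp_def split_def intro!: continuous_intros)
  show "set_integrable lebesgue S (\<lambda>t. 2 powr p * (norm (f t) powr p + norm (g t) powr p))"
    using f g S by (intro set_integrable_mult_right set_integral_add(1)) (auto simp: Lp_iff_set_integrable)
qed (rule norm_add_powr_le[OF p])

lemma Lp_diff:
  fixes f g :: "real \<Rightarrow> 'b::real_normed_vector"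
  assumes "0 \<le> p" "S \<in> sets lebesgue" "Lp p S f" "Lp p S g"
  shows "Lp p S (\<lambda>t. f t - g t)"
  using Lp_add[OF assms(1-3) Lp_compose[OF assms(1,2,4), of uminus 1]]
  by (simp add: continuous_on_minus)

lemma Lp_zero: "Lp p S (\<lambda>t. 0 :: 'b::real_normed_vector)"
proof -
  have "strongly_measurable_on S (\<lambda>t. 0 :: 'b)"
    by (rule strongly_measurable_onI[of "\<lambda>n t. 0"]) (simp_all add: simple_fun_leb_def vimage_const)
  then show ?thesis by (simp add: Lp_def)
qed

lemma Lp_continuous_on_Icc:
  fixes f :: "real \<Rightarrow> 'b::euclidean_space"
  assumes p: "0 \<le> p" and f: "continuous_on {a..b} f"
  shows "Lp p {a..b} f"
proof -
  have "set_borel_measurable lborel {a..b} f"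
    using borel_measurable_continuous_on_indicator[OF _ f] by (simp add: set_borel_measurable_def)
  then have measurable: "strongly_measurable_on {a..b} f"
    by (simp add: strongly_measurable_on_iff_set_borel_measurable set_borel_measurable_def
        measurable_completion)
  have "bounded (f ` {a..b})"
    by (intro compact_imp_bounded compact_continuous_image f) simp
  then obtain B where B: "\<And>t. t \<in> {a..b} \<Longrightarrow> norm (f t) \<le> B"
    unfolding bounded_iff by blast
  show ?thesis
  proof (rule LpI[OF _ measurable])
    show "set_integrable lebesgue {a..b} (\<lambda>t. B powr p)"
      by simp
    show "norm (f t) powr p \<le> B powr p" if "t \<in> {a..b}" for t
      using B[OF that] p by (intro powr_mono2) auto
  qed simp
qed

lemma Lp_translate:
  fixes f :: "real \<Rightarrow> 'b::real_normed_vector"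
  assumes f: "Lp p S f" and S: "S \<in> sets lebesgue"
  shows "Lp p {t. t + c \<in> S} (\<lambda>t. f (t + c))"
proof -
  have shift: "indicator {t. t + c \<in> S} t *\<^sub>R norm (f (t + c)) powr p =
      indicator S (c + 1 * t) *\<^sub>R norm (f (c + 1 * t)) powr p" for t
    by (simp add: add.commute split: split_indicator)
  have "integrable lebesgue (\<lambda>t. indicator S t *\<^sub>R norm (f t) powr p)"
    using f S by (simp add: Lp_iff_set_integrable set_integrable_def)
  from lebesgue_integrable_real_affine[OF this, of 1 c]
  have "set_integrable lebesgue {t. t + c \<in> S} (\<lambda>t. norm (f (t + c)) powr p)"
    unfolding set_integrable_def shift by simp
  moreover have "{t. t + c \<in> S} \<in> sets lebesgue"
  proof -
    have "{t. t + c \<in> S} = (+) (- c) ` S"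
      by (auto simp: image_iff intro!: bexI[of _ "_ + c"])
    then show ?thesis
      using S by (simp only: lebesgue_sets_translation)
  qed
  ultimately show ?thesis
    using f S strongly_measurable_on_translate[of S f c] by (simp add: Lp_iff_set_integrable)
qed

lemma Lp_extend_by_zero:
  fixes f :: "real \<Rightarrow> 'b::real_normed_vector"
  assumes f: "Lp p S f" and S: "S \<in> sets lebesgue" and S': "S' \<in> sets lebesgue"
  shows "Lp p S' (\<lambda>t. if t \<in> S then f t else 0)"
proof (rule LpI[OF S'])
  show "strongly_measurable_on S' (\<lambda>t. if t \<in> S then f t else 0)"
    using f S by (intro strongly_measurable_on_extend_by_zero) (auto simp: Lp_def)
  have "integrable lebesgue (\<lambda>t. indicator S t *\<^sub>R norm (f t) powr p)"
    using f S by (simp add: Lp_iff_set_integrable set_integrable_def)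
  then show "set_integrable lebesgue S' (\<lambda>t. indicator S t *\<^sub>R norm (f t) powr p)"
    unfolding set_integrable_def by (rule integrable_mult_indicator[OF S'])
qed auto

lemma Lp_norm_nonneg [simp]: "0 \<le> Lp_norm p S f"
  by (simp add: Lp_norm_def)

lemma Lp_norm_eq_set_integral:
  assumes f: "Lp p S f" and S: "S \<in> sets lebesgue"
  shows "Lp_norm p S f = (LINT t:S|lebesgue. norm (f t) powr p) powr (1 / p)"
proof -
  have "(LINT t:S|lebesgue. norm (f t) powr p) =
      enn2real (\<integral>\<^sup>+ t. ennreal (indicator S t *\<^sub>R norm (f t) powr p) \<partial>lebesgue)"
    unfolding set_lebesgue_integral_def
    using f S by (intro integral_eq_nn_integral AE_I2)
      (auto simp: Lp_iff_set_integrable set_integrable_def integrable_iff_bounded)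
  also have "\<dots> = enn2real (\<integral>\<^sup>+ t\<in>S. ennreal (norm (f t) powr p) \<partial>lebesgue)"
    by (intro arg_cong[of _ _ enn2real] nn_integral_cong) (auto split: split_indicator)
  finally show ?thesis
    by (simp add: Lp_norm_def)
qed

lemma Lp_norm_eq_0_iff:
  assumes f: "Lp p S f" and S: "S \<in> sets lebesgue"
  shows "Lp_norm p S f = 0 \<longleftrightarrow> (AE t in lebesgue. t \<in> S \<longrightarrow> f t = 0)"
proof -
  have "Lp_norm p S f = 0 \<longleftrightarrow> (LINT t:S|lebesgue. norm (f t) powr p) = 0"
    by (simp add: Lp_norm_eq_set_integral[OF assms])
  also have "\<dots> \<longleftrightarrow> (AE t in lebesgue. indicator S t *\<^sub>R norm (f t) powr p = 0)"
    unfolding set_lebesgue_integral_def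
    using f S by (intro integral_nonneg_eq_0_iff_AE) (auto simp: Lp_iff_set_integrable set_integrable_def)
  also have "\<dots> \<longleftrightarrow> (AE t in lebesgue. t \<in> S \<longrightarrow> f t = 0)"
    by (intro AE_cong) (auto split: split_indicator)
  finally show ?thesis .
qed

lemma Lp_norm_eq_0I:
  assumes "AE t in lebesgue. t \<in> S \<longrightarrow> f t = 0"
  shows "Lp_norm p S f = 0"
proof -
  have "AE t in lebesgue. ennreal (norm (f t) powr p) * indicator S t = 0"
    using assms by eventually_elim auto
  from nn_integral_cong_AE[OF this] show ?thesis by (simp add: Lp_norm_def)
qed

lemma Lp_norm_mono_set:
  fixes f :: "real \<Rightarrow> 'b::real_normed_vector"
  assumes f: "Lp p S f" and p: "0 < p" and "S' \<subseteq> S"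
  shows "Lp_norm p S' f \<le> Lp_norm p S f"
proof -
  have "(\<integral>\<^sup>+ t\<in>S'. ennreal (norm (f t) powr p) \<partial>lebesgue) \<le>
      (\<integral>\<^sup>+ t\<in>S. ennreal (norm (f t) powr p) \<partial>lebesgue)"
    using assms(3) by (rule nn_set_integral_set_mono)
  then show ?thesis
    unfolding Lp_norm_def using f p
    by (intro powr_mono2 enn2real_mono) (auto simp: Lp_def)
qed

lemma Lp_norm_Icc_le:
  fixes f :: "real \<Rightarrow> 'b::real_normed_vector"
  assumes f: "Lp p {a..b} f" and p: "0 < p" and ab: "a \<le> b"
    and B: "\<And>t. t \<in> {a..b} \<Longrightarrow> norm (f t) \<le> B"
  shows "Lp_norm p {a..b} f \<le> (b - a) powr (1 / p) * B"
proof -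
  have B_nonneg: "0 \<le> B"
    using B[of a] ab by (auto intro: order_trans[OF norm_ge_zero])
  have "(LINT t:{a..b}|lebesgue. norm (f t) powr p) \<le> (LINT t:{a..b}|lebesgue. B powr p)"
    using f p B by (intro set_integral_mono powr_mono2) (auto simp: Lp_iff_set_integrable)
  also have "\<dots> = (b - a) * B powr p"
    using ab by (simp add: set_integral_const)
  finally have "Lp_norm p {a..b} f \<le> ((b - a) * B powr p) powr (1 / p)"
    using f p by (subst Lp_norm_eq_set_integral)
      (auto intro!: powr_mono2 simp: set_lebesgue_integral_def intro: integral_nonneg_AE)
  also have "\<dots> = (b - a) powr (1 / p) * B"
    using p ab B_nonneg by (simp add: powr_mult powr_powr)
  finally show ?thesis .
qed

lemma le_add_powr:
  fixes u M :: real
  assumes p: "1 \<le> p" and M: "0 < M" and "0 \<le> u"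
  shows "u \<le> M + M powr (1 - p) * u powr p"
proof (cases "u \<le> M")
  case False
  then have "u = M powr (1 - p) * (u * M powr (p - 1))"
    using M by (simp add: powr_add[symmetric])
  also have "\<dots> \<le> M powr (1 - p) * (u * u powr (p - 1))"
    using False p M by (intro mult_left_mono powr_mono2) auto
  also have "u * u powr (p - 1) = u powr p"
    using False M powr_add[of u 1 "p - 1"] by simp
  finally show ?thesis
    using M by linarith
next
  case True
  then show ?thesis
    by (simp add: add_increasing2)
qed

lemma set_integrable_norm_if_Lp:
  fixes f :: "real \<Rightarrow> 'b::real_normed_vector"
  assumes p: "1 \<le> p" and f: "Lp p {a..b} f"
  shows "set_integrable lebesgue {a..b} (\<lambda>t. norm (f t))"
proof (rule set_integrable_bound)
  show "set_integrable lebesgue {a..b} (\<lambda>t. 1 + norm (f t) powr p)"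
    using f by (intro set_integral_add(1)) (auto simp: Lp_iff_set_integrable)
  have "strongly_measurable_on {a..b} (\<lambda>t. norm (f t))"
    using f by (intro strongly_measurable_on_compose[where H = norm] continuous_intros) (simp add: Lp_def)
  then show "set_borel_measurable lebesgue {a..b} (\<lambda>t. norm (f t))"
    by (simp add: strongly_measurable_on_iff_set_borel_measurable)
  have "norm (f t) \<le> 1 + norm (f t) powr p" for t
    using le_add_powr[OF p zero_less_one norm_ge_zero] by simp
  then show "AE t in lebesgue. t \<in> {a..b} \<longrightarrow> norm (norm (f t)) \<le> norm (1 + norm (f t) powr p)"
    by (simp add: add_nonneg_nonneg abs_of_nonneg)
qed

lemma set_integral_norm_le_Lp_norm:
  fixes f :: "real \<Rightarrow> 'b::real_normed_vector"
  assumes p: "1 \<le> p" and f: "Lp p {a..b} f" and ab: "a \<le> b"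
  shows "(LINT t:{a..b}|lebesgue. norm (f t)) \<le> (1 + (b - a)) * Lp_norm p {a..b} f"
proof (cases "Lp_norm p {a..b} f = 0")
  case True
  then have "AE t in lebesgue. t \<in> {a..b} \<longrightarrow> f t = 0"
    using f by (simp add: Lp_norm_eq_0_iff)
  then have "AE t in lebesgue. indicator {a..b} t *\<^sub>R norm (f t) = 0"
    by eventually_elim (auto split: split_indicator)
  then have "(LINT t:{a..b}|lebesgue. norm (f t)) = 0"
    unfolding set_lebesgue_integral_def by (rule integral_eq_zero_AE)
  then show ?thesis using True by simp
next
  case False
  define N where "N = Lp_norm p {a..b} f"
  have N: "0 < N"
    using False by (simp add: N_def less_le)
  have integrable: "set_integrable lebesgue {a..b} (\<lambda>t. N)"
      "set_integrable lebesgue {a..b} (\<lambda>t. N powr (1 - p) * norm (f t) powr p)"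
    using f by (auto simp: Lp_iff_set_integrable)
  have "0 \<le> (LINT t:{a..b}|lebesgue. norm (f t) powr p)"
    by (simp add: set_lebesgue_integral_def integral_nonneg_AE)
  then have integral_powr: "(LINT t:{a..b}|lebesgue. norm (f t) powr p) = N powr p"
    using p f by (simp add: N_def Lp_norm_eq_set_integral powr_powr)
  have "(LINT t:{a..b}|lebesgue. norm (f t)) \<le>
      (LINT t:{a..b}|lebesgue. N + N powr (1 - p) * norm (f t) powr p)"
    by (rule set_integral_mono[OF set_integrable_norm_if_Lp[OF p f] set_integral_add(1)[OF integrable]])
      (rule le_add_powr[OF p N norm_ge_zero])
  also have "\<dots> = (b - a) * N + N powr (1 - p) * N powr p"
    using ab integrable by (subst set_integral_add(2)) (simp_all add: set_integral_const integral_powr)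
  also have "\<dots> = (1 + (b - a)) * N"
    using N by (simp add: powr_add[symmetric] algebra_simps)
  finally show ?thesis
    by (simp add: N_def)
qed

text \<open>The codomain need not be separable, so Bochner integration is not available; the
  Henstock--Kurzweil integral is bounded through the scalar function \<open>norm \<circ> f\<close>.\<close>

lemma norm_integral_le_Lp_norm:
  fixes f :: "real \<Rightarrow> 'b::banach"
  assumes p: "1 \<le> p" and f: "Lp p {a..b} f" and ab: "a \<le> b" and integrable: "f integrable_on {a..b}"
  shows "norm (integral {a..b} f) \<le> (1 + (b - a)) * Lp_norm p {a..b} f"
proof -
  have "norm (integral {a..b} f) \<le> integral {a..b} (\<lambda>t. norm (f t))"
    using set_lebesgue_integral_eq_integral(1)[OF set_integrable_norm_if_Lp[OF p f]]
    by (intro Henstock_Kurzweil_Integration.integral_norm_bound_integral[OF integrable]) auto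
  also have "\<dots> = (LINT t:{a..b}|lebesgue. norm (f t))"
    using set_lebesgue_integral_eq_integral(2)[OF set_integrable_norm_if_Lp[OF p f]] ..
  also have "\<dots> \<le> (1 + (b - a)) * Lp_norm p {a..b} f"
    by (rule set_integral_norm_le_Lp_norm[OF p f ab])
  finally show ?thesis .
qed

lemma norm_primitive_le_Lp_norm:
  fixes f :: "real \<Rightarrow> 'b::banach"
  assumes p: "1 \<le> p" and f: "Lp p {a..b} f" and integrable: "f integrable_on {a..b}" and t: "t \<in> {a..b}"
  shows "norm (integral {a..t} f) \<le> (1 + (t - a)) * Lp_norm p {a..b} f"
proof -
  have "norm (integral {a..t} f) \<le> (1 + (t - a)) * Lp_norm p {a..t} f"
    using p t integrable_subinterval_real[OF integrable, of a t]
    by (intro norm_integral_le_Lp_norm Lp_subset[OF f]) auto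
  also have "\<dots> \<le> (1 + (t - a)) * Lp_norm p {a..b} f"
    using t p by (intro mult_left_mono Lp_norm_mono_set[OF f]) auto
  finally show ?thesis .
qed

section \<open>The Riemann--Stieltjes integral of a continuous function\<close>

definition fine_partition :: "real \<Rightarrow> real \<Rightarrow> real \<Rightarrow> real list \<Rightarrow> real list \<Rightarrow> bool" where
  "fine_partition a b \<delta> xs ts \<longleftrightarrow>
     xs \<noteq> [] \<and> hd xs = a \<and> last xs = b \<and> sorted xs \<and>
     (\<forall>i<length xs - 1. xs ! Suc i - xs ! i < \<delta>) \<and>
     length ts = length xs - 1 \<and>
     (\<forall>i<length ts. xs ! i \<le> ts ! i \<and> ts ! i \<le> xs ! Suc i)"

definition partition_filter :: "real \<Rightarrow> real \<Rightarrow> (real list \<times> real list) filter" where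
  "partition_filter a b = (INF \<delta>\<in>{0<..}. principal {(xs, ts). fine_partition a b \<delta> xs ts})"

fun RS_sum ::
  "(real \<Rightarrow> 'a::real_normed_vector \<Rightarrow>\<^sub>L 'b::real_normed_vector) \<Rightarrow> (real \<Rightarrow> 'a) \<Rightarrow>
    real list \<times> real list \<Rightarrow> 'b" where
  "RS_sum \<mu> \<phi> (xs, ts) =
     (\<Sum>i<length ts. blinfun_apply (\<mu> (xs ! Suc i) - \<mu> (xs ! i)) (\<phi> (ts ! i)))"

lemma fine_partition_mono:
  "fine_partition a b \<delta> xs ts \<Longrightarrow> \<delta> \<le> \<delta>' \<Longrightarrow> fine_partition a b \<delta>' xs ts"
  unfolding fine_partition_def by force

lemma eventually_partition_filter:
  "(\<forall>\<^sub>F P in partition_filter a b. Q P) \<longleftrightarrow>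
    (\<exists>\<delta>>0. \<forall>xs ts. fine_partition a b \<delta> xs ts \<longrightarrow> Q (xs, ts))"
proof -
  have "\<exists>\<epsilon>\<in>{0<..}. principal {(xs, ts). fine_partition a b \<epsilon> xs ts} \<le>
      inf (principal {(xs, ts). fine_partition a b \<delta> xs ts})
        (principal {(xs, ts). fine_partition a b \<delta>' xs ts})"
    if "0 < \<delta>" "0 < \<delta>'" for \<delta> \<delta>' :: real
    using that by (intro bexI[of _ "min \<delta> \<delta>'"]) (auto elim: fine_partition_mono)
  then show ?thesis
    unfolding partition_filter_def
    by (subst eventually_INF_base) (auto simp: eventually_principal intro: gt_ex)
qed

lemma has_RS_integral_iff_tendsto:
  "has_RS_integral \<mu> \<phi> a b I \<longleftrightarrow> (RS_sum \<mu> \<phi> \<longlongrightarrow> I) (partition_filter a b)"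
  unfolding has_RS_integral_def tendsto_iff eventually_partition_filter
  by (simp add: fine_partition_def dist_norm)

lemma fine_partition_points:
  assumes "fine_partition a b \<delta> xs ts"
  shows "set xs \<subseteq> {a..b}"
proof
  fix x assume "x \<in> set xs"
  then obtain i where i: "i < length xs" "x = xs ! i"
    by (auto simp: in_set_conv_nth)
  have "xs ! 0 \<le> xs ! i" "xs ! i \<le> xs ! (length xs - 1)"
    using assms i by (auto simp: fine_partition_def intro!: sorted_nth_mono)
  then show "x \<in> {a..b}"
    using assms i by (auto simp: fine_partition_def hd_conv_nth last_conv_nth)
qed

lemma fine_partition_tags:
  assumes "fine_partition a b \<delta> xs ts" "i < length ts"
  shows "ts ! i \<in> {a..b}"
proof -
  have "xs ! i \<in> set xs" "xs ! Suc i \<in> set xs"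
    using assms by (auto simp: fine_partition_def)
  then have "a \<le> xs ! i" "xs ! Suc i \<le> b"
    using fine_partition_points[OF assms(1)] by auto
  moreover have "xs ! i \<le> ts ! i" "ts ! i \<le> xs ! Suc i"
    using assms by (auto simp: fine_partition_def)
  ultimately show ?thesis by auto
qed

lemma ex_fine_partition:
  assumes ab: "a \<le> b" and \<delta>: "0 < \<delta>"
  shows "\<exists>xs ts. fine_partition a b \<delta> xs ts"
proof -
  obtain n :: nat where n: "max 0 ((b - a) / \<delta>) < real n"
    using reals_Archimedean2 by blast
  then have n_pos: "0 < n" by simp
  define x where "x i = a + (b - a) * real i / real n" for i
  have "(b - a) / real n < \<delta>"
    using n n_pos \<delta> by (simp add: field_simps)
  then have step: "x (Suc i) - x i < \<delta>" for i
    by (simp add: x_def algebra_simps add_divide_distrib diff_divide_distrib)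
  have mono: "x i \<le> x j" if "i \<le> j" for i j
    using that ab n_pos by (auto simp: x_def intro!: divide_right_mono mult_left_mono)
  have nth: "map x [0..<Suc n] ! i = x i" if "i \<le> n" for i
    using that by (simp del: upt_Suc)
  have "fine_partition a b \<delta> (map x [0..<Suc n]) (map x [0..<n])"
    unfolding fine_partition_def
  proof (intro conjI)
    show "hd (map x [0..<Suc n]) = a"
      by (simp add: hd_map x_def del: upt_Suc)
    show "last (map x [0..<Suc n]) = b"
      using n_pos by (simp add: x_def)
    show "sorted (map x [0..<Suc n])"
      by (auto simp: sorted_iff_nth_mono mono simp del: upt_Suc)
  qed (auto simp: nth step mono simp del: upt_Suc)
  then show ?thesis by blast
qed

lemma partition_filter_neq_bot: "a \<le> b \<Longrightarrow> partition_filter a b \<noteq> bot"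
  unfolding trivial_limit_def eventually_partition_filter by (auto dest: ex_fine_partition)

lemma has_RS_integral_unique:
  "a \<le> b \<Longrightarrow> has_RS_integral \<mu> \<phi> a b I \<Longrightarrow> has_RS_integral \<mu> \<phi> a b J \<Longrightarrow> I = J"
  unfolding has_RS_integral_iff_tendsto by (rule tendsto_unique[OF partition_filter_neq_bot])

lemma RS_sum_add: "RS_sum \<mu> (\<lambda>t. \<phi> t + \<psi> t) = (\<lambda>P. RS_sum \<mu> \<phi> P + RS_sum \<mu> \<psi> P)"
  by (auto simp: fun_eq_iff blinfun.add_right sum.distrib)

lemma RS_sum_diff: "RS_sum \<mu> (\<lambda>t. \<phi> t - \<psi> t) = (\<lambda>P. RS_sum \<mu> \<phi> P - RS_sum \<mu> \<psi> P)"
  by (auto simp: fun_eq_iff blinfun.diff_right sum_subtractf)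

lemma partition_var_le_total_variation:
  assumes "bounded_variation_on \<mu> a b" "sorted xs" "set xs \<subseteq> {a..b}"
  shows "partition_var \<mu> xs \<le> total_variation \<mu> a b"
  using assms unfolding total_variation_def bounded_variation_on_def
  by (intro cSup_upper) auto

lemma total_variation_nonneg:
  assumes "bounded_variation_on \<mu> a b"
  shows "0 \<le> total_variation \<mu> a b"
  using partition_var_le_total_variation[OF assms, of "[]"] by (simp add: partition_var_def)

lemma norm_sum_increments_le:
  fixes \<mu> :: "real \<Rightarrow> 'a::real_normed_vector \<Rightarrow>\<^sub>L 'b::real_normed_vector"
  assumes \<mu>: "bounded_variation_on \<mu> a b" and xs: "sorted xs" "set xs \<subseteq> {a..b}" and B: "0 \<le> B"
    and v: "\<And>i. i < length xs - 1 \<Longrightarrow> xs ! Suc i \<noteq> xs ! i \<Longrightarrow> norm (v i) \<le> B"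
  shows "norm (\<Sum>i<length xs - 1. blinfun_apply (\<mu> (xs ! Suc i) - \<mu> (xs ! i)) (v i)) \<le>
    total_variation \<mu> a b * B"
proof -
  have "norm (blinfun_apply (\<mu> (xs ! Suc i) - \<mu> (xs ! i)) (v i)) \<le>
      norm (\<mu> (xs ! Suc i) - \<mu> (xs ! i)) * B" if "i < length xs - 1" for i
  proof (cases "xs ! Suc i = xs ! i")
    case False
    then show ?thesis
      using v[OF that] by (intro order_trans[OF norm_blinfun] mult_left_mono) auto
  qed auto
  then have "norm (\<Sum>i<length xs - 1. blinfun_apply (\<mu> (xs ! Suc i) - \<mu> (xs ! i)) (v i)) \<le>
      (\<Sum>i<length xs - 1. norm (\<mu> (xs ! Suc i) - \<mu> (xs ! i)) * B)"
    by (intro sum_norm_le) auto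
  also have "\<dots> = partition_var \<mu> xs * B"
    by (simp add: partition_var_def sum_distrib_right)
  also have "\<dots> \<le> total_variation \<mu> a b * B"
    by (intro mult_right_mono partition_var_le_total_variation \<mu> xs B)
  finally show ?thesis .
qed

lemma has_RS_integral_norm_le:
  fixes \<mu> :: "real \<Rightarrow> 'a::real_normed_vector \<Rightarrow>\<^sub>L 'a"
  assumes ab: "a \<le> b" and \<mu>: "bounded_variation_on \<mu> a b" and I: "has_RS_integral \<mu> \<phi> a b I"
    and B: "\<And>t. t \<in> {a..b} \<Longrightarrow> norm (\<phi> t) \<le> B"
  shows "norm I \<le> total_variation \<mu> a b * B"
proof -
  have B_nonneg: "0 \<le> B"
    using B[of a] ab by (auto intro: order_trans[OF norm_ge_zero])
  have RS_sum_le: "norm (RS_sum \<mu> \<phi> (xs, ts)) \<le> total_variation \<mu> a b * B"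
    if fine: "fine_partition a b 1 xs ts" for xs ts
  proof -
    have length_ts: "length ts = length xs - 1" and "sorted xs"
      using fine by (auto simp: fine_partition_def)
    then show ?thesis
      unfolding RS_sum.simps length_ts
      by (intro norm_sum_increments_le[OF \<mu> _ fine_partition_points[OF fine] B_nonneg] B
          fine_partition_tags[OF fine]) (simp_all add: length_ts)
  qed
  have "\<forall>\<^sub>F P in partition_filter a b. norm (RS_sum \<mu> \<phi> P) \<le> total_variation \<mu> a b * B"
    unfolding eventually_partition_filter using RS_sum_le by (intro exI[of _ 1]) simp
  with I show ?thesis
    unfolding has_RS_integral_iff_tendsto by (rule Lim_norm_ubound[OF partition_filter_neq_bot[OF ab]])
qed

lemma sorted_nth_gap:
  fixes zs :: "'a::linorder list"
  assumes zs: "sorted zs" and c: "c \<in> set zs" and j: "Suc j < length zs" and "c < zs ! Suc j"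
  shows "c \<le> zs ! j"
proof -
  obtain k where k: "k < length zs" "c = zs ! k"
    using c by (auto simp: in_set_conv_nth)
  have "k < Suc j"
    using assms(4) k sorted_nth_mono[OF zs, of "Suc j" k] by (meson not_less)
  then show ?thesis
    using k j sorted_nth_mono[OF zs, of k j] by simp
qed

lemma sum_increments_between:
  fixes m :: "real \<Rightarrow> 'c::ab_group_add"
  assumes zs: "sorted zs" and c: "c \<in> set zs" and d: "d \<in> set zs" and cd: "c \<le> d"
  shows "(\<Sum>j<length zs - 1. if c < zs ! Suc j \<and> zs ! Suc j \<le> d
           then m (zs ! Suc j) - m (zs ! j) else 0) = m d - m c"
proof -
  define clamp where "clamp z = max c (min d z)" for z
  have clamp: "(if c < zs ! Suc j \<and> zs ! Suc j \<le> d then m (zs ! Suc j) - m (zs ! j) else 0) =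
      m (clamp (zs ! Suc j)) - m (clamp (zs ! j))" if "j < length zs - 1" for j
  proof -
    have j: "Suc j < length zs"
      using that by simp
    then have "zs ! j \<le> zs ! Suc j"
      by (intro sorted_nth_mono[OF zs]) auto
    then show ?thesis
      using cd sorted_nth_gap[OF zs c j] sorted_nth_gap[OF zs d j]
      by (auto simp: clamp_def max_def min_def not_less not_le intro: arg_cong[where f = m])
  qed
  have bounds: "zs ! 0 \<le> z" "z \<le> zs ! (length zs - 1)" if "z \<in> set zs" for z
    using that by (auto simp: in_set_conv_nth intro!: sorted_nth_mono[OF zs])
  have "(\<Sum>j<length zs - 1. if c < zs ! Suc j \<and> zs ! Suc j \<le> d
           then m (zs ! Suc j) - m (zs ! j) else 0)
      = (\<Sum>j<length zs - 1. m (clamp (zs ! Suc j)) - m (clamp (zs ! j)))"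
    by (intro sum.cong refl clamp) simp
  also have "\<dots> = m (clamp (zs ! (length zs - 1))) - m (clamp (zs ! 0))"
    by (rule sum_lessThan_telescope)
  also have "clamp (zs ! (length zs - 1)) = d"
    using bounds(2)[OF d] cd by (simp add: clamp_def)
  also have "clamp (zs ! 0) = c"
    using bounds(1)[OF c] by (simp add: clamp_def max_def min_def)
  finally show ?thesis .
qed

text \<open>The left-continuous step function with value \<open>\<phi> (t\<^sub>i)\<close> on \<open>{x\<^sub>i<..x\<^sub>i\<^sub>+\<^sub>1}\<close>; it turns a
  Riemann--Stieltjes sum into a sum over any refinement, so that two sums can be compared.\<close>

definition tag_step :: "(real \<Rightarrow> 'a::real_normed_vector) \<Rightarrow> real list \<Rightarrow> real list \<Rightarrow> real \<Rightarrow> 'a" where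
  "tag_step \<phi> xs ts \<theta> = (\<Sum>i<length ts. if xs ! i < \<theta> \<and> \<theta> \<le> xs ! Suc i then \<phi> (ts ! i) else 0)"

lemma RS_sum_refine:
  assumes fine: "fine_partition a b \<delta> xs ts" and zs: "sorted zs" "set xs \<subseteq> set zs"
  shows "RS_sum \<mu> \<phi> (xs, ts) =
    (\<Sum>j<length zs - 1. blinfun_apply (\<mu> (zs ! Suc j) - \<mu> (zs ! j)) (tag_step \<phi> xs ts (zs ! Suc j)))"
proof -
  define inc where "inc i j = (if xs ! i < zs ! Suc j \<and> zs ! Suc j \<le> xs ! Suc i
    then \<mu> (zs ! Suc j) - \<mu> (zs ! j) else 0)" for i j
  have inc: "(\<Sum>j<length zs - 1. inc i j) = \<mu> (xs ! Suc i) - \<mu> (xs ! i)" if "i < length ts" for i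
  proof -
    have "Suc i < length xs"
      using fine that by (auto simp: fine_partition_def)
    then have "xs ! i \<in> set zs" "xs ! Suc i \<in> set zs" "xs ! i \<le> xs ! Suc i"
      using zs fine by (auto simp: fine_partition_def intro: sorted_nth_mono)
    from sum_increments_between[OF zs(1) this] show ?thesis
      unfolding inc_def .
  qed
  have "(\<Sum>j<length zs - 1. blinfun_apply (\<mu> (zs ! Suc j) - \<mu> (zs ! j)) (tag_step \<phi> xs ts (zs ! Suc j)))
     = (\<Sum>j<length zs - 1. \<Sum>i<length ts. blinfun_apply (inc i j) (\<phi> (ts ! i)))"
    unfolding tag_step_def blinfun.sum_right by (intro sum.cong refl) (auto simp: inc_def)
  also have "\<dots> = (\<Sum>i<length ts. \<Sum>j<length zs - 1. blinfun_apply (inc i j) (\<phi> (ts ! i)))"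
    by (rule sum.swap)
  also have "\<dots> = (\<Sum>i<length ts. blinfun_apply (\<Sum>j<length zs - 1. inc i j) (\<phi> (ts ! i)))"
    by (simp only: blinfun.sum_left)
  also have "\<dots> = RS_sum \<mu> \<phi> (xs, ts)"
    by (simp add: inc del: One_nat_def)
  finally show ?thesis ..
qed

lemma sorted_cell_ex1:
  fixes xs :: "'a::linorder list"
  assumes xs: "sorted xs" "xs \<noteq> []" and \<theta>: "hd xs < \<theta>" "\<theta> \<le> last xs"
  shows "\<exists>!i. Suc i < length xs \<and> xs ! i < \<theta> \<and> \<theta> \<le> xs ! Suc i"
proof -
  define n where "n = (LEAST n. \<theta> \<le> xs ! n)"
  have last: "\<theta> \<le> xs ! (length xs - 1)"
    using xs \<theta> by (simp add: last_conv_nth)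
  have n: "\<theta> \<le> xs ! n"
    unfolding n_def using last by (rule LeastI)
  have "n \<le> length xs - 1"
    unfolding n_def using last by (rule Least_le)
  moreover have below: "xs ! m < \<theta>" if "m < n" for m
    using not_less_Least[OF that[unfolded n_def]] by simp
  moreover have "n \<noteq> 0"
    using n xs(2) \<theta>(1) by (metis hd_conv_nth not_less)
  then obtain i where i: "n = Suc i"
    using not0_implies_Suc by blast
  ultimately have cell: "Suc i < length xs" "xs ! i < \<theta>" "\<theta> \<le> xs ! Suc i"
    using n xs(2) by (auto simp: Suc_le_lessD less_diff_conv)
  moreover have "j = i" if "Suc j < length xs" "xs ! j < \<theta>" "\<theta> \<le> xs ! Suc j" for j
  proof -
    have "\<not> Suc i \<le> j" "\<not> Suc j \<le> i"
      using that cell sorted_nth_mono[OF xs(1), of "Suc i" j] sorted_nth_mono[OF xs(1), of "Suc j" i]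
      by auto
    then show ?thesis by simp
  qed
  ultimately show ?thesis by blast
qed

lemma tag_step_near:
  assumes fine: "fine_partition a b \<delta> xs ts" and \<theta>: "a < \<theta>" "\<theta> \<le> b"
  obtains s where "s \<in> {a..b}" "\<bar>s - \<theta>\<bar> < \<delta>" "tag_step \<phi> xs ts \<theta> = \<phi> s"
proof -
  have "\<exists>!i. Suc i < length xs \<and> xs ! i < \<theta> \<and> \<theta> \<le> xs ! Suc i"
    using fine \<theta> by (intro sorted_cell_ex1) (auto simp: fine_partition_def)
  then obtain i where i: "Suc i < length xs" "xs ! i < \<theta>" "\<theta> \<le> xs ! Suc i"
      and unique: "\<And>j. Suc j < length xs \<Longrightarrow> xs ! j < \<theta> \<and> \<theta> \<le> xs ! Suc j \<Longrightarrow> j = i"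
    by blast
  have length_ts: "length ts = length xs - 1"
    using fine by (simp add: fine_partition_def)
  have cell: "xs ! j < \<theta> \<and> \<theta> \<le> xs ! Suc j \<longleftrightarrow> j = i" if "j < length ts" for j
    using that i unique[of j] by (auto simp: length_ts)
  have i_less: "i < length ts"
    using i(1) by (simp add: length_ts)
  have "tag_step \<phi> xs ts \<theta> = (\<Sum>j<length ts. if j = i then \<phi> (ts ! i) else 0)"
    unfolding tag_step_def by (intro sum.cong refl) (simp add: cell)
  also have "\<dots> = \<phi> (ts ! i)"
    using i_less by simp
  finally have "tag_step \<phi> xs ts \<theta> = \<phi> (ts ! i)" .
  moreover have "xs ! i \<le> ts ! i" "ts ! i \<le> xs ! Suc i" "xs ! Suc i - xs ! i < \<delta>"
    using fine i(1) by (auto simp: fine_partition_def)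
  then have "\<bar>ts ! i - \<theta>\<bar> < \<delta>"
    using i by linarith
  moreover have "ts ! i \<in> {a..b}"
    by (rule fine_partition_tags[OF fine i_less])
  ultimately show ?thesis
    using that by blast
qed

lemma norm_RS_sum_diff_le:
  assumes \<mu>: "bounded_variation_on \<mu> a b" and e: "0 \<le> e"
    and osc: "\<And>s s'. s \<in> {a..b} \<Longrightarrow> s' \<in> {a..b} \<Longrightarrow> \<bar>s - s'\<bar> < 2 * \<delta> \<Longrightarrow> norm (\<phi> s - \<phi> s') \<le> e"
    and xs: "fine_partition a b \<delta> xs ts" and ys: "fine_partition a b \<delta> ys us"
  shows "norm (RS_sum \<mu> \<phi> (xs, ts) - RS_sum \<mu> \<phi> (ys, us)) \<le> total_variation \<mu> a b * e"
proof -
  define zs where "zs = sort (xs @ ys)"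
  have zs: "sorted zs" "set xs \<subseteq> set zs" "set ys \<subseteq> set zs" "set zs \<subseteq> {a..b}"
    using fine_partition_points[OF xs] fine_partition_points[OF ys] by (auto simp: zs_def)
  have "RS_sum \<mu> \<phi> (xs, ts) - RS_sum \<mu> \<phi> (ys, us) =
     (\<Sum>j<length zs - 1. blinfun_apply (\<mu> (zs ! Suc j) - \<mu> (zs ! j))
        (tag_step \<phi> xs ts (zs ! Suc j) - tag_step \<phi> ys us (zs ! Suc j)))"
    unfolding RS_sum_refine[OF xs zs(1,2)] RS_sum_refine[OF ys zs(1,3)]
    by (simp add: blinfun.diff_right sum_subtractf)
  also have "norm \<dots> \<le> total_variation \<mu> a b * e"
  proof (rule norm_sum_increments_le[OF \<mu> zs(1,4) e])
    fix j assume j: "j < length zs - 1" "zs ! Suc j \<noteq> zs ! j"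
    have "zs ! j \<in> {a..b}" "zs ! Suc j \<in> {a..b}"
      using j zs(4) by (auto intro!: subsetD[OF zs(4)] simp del: atLeastAtMost_iff)
    moreover have "zs ! j \<le> zs ! Suc j"
      using j by (intro sorted_nth_mono zs) auto
    ultimately have \<theta>: "a < zs ! Suc j" "zs ! Suc j \<le> b"
      using j by auto
    obtain s where s: "s \<in> {a..b}" "\<bar>s - zs ! Suc j\<bar> < \<delta>" "tag_step \<phi> xs ts (zs ! Suc j) = \<phi> s"
      using tag_step_near[OF xs \<theta>] .
    obtain s' where s': "s' \<in> {a..b}" "\<bar>s' - zs ! Suc j\<bar> < \<delta>" "tag_step \<phi> ys us (zs ! Suc j) = \<phi> s'"
      using tag_step_near[OF ys \<theta>] .
    have "\<bar>s - s'\<bar> < 2 * \<delta>"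
      using s(2) s'(2) by linarith
    then show "norm (tag_step \<phi> xs ts (zs ! Suc j) - tag_step \<phi> ys us (zs ! Suc j)) \<le> e"
      unfolding s(3) s'(3) by (rule osc[OF s(1) s'(1)])
  qed
  finally show ?thesis .
qed

lemma cauchy_filter_RS_sum:
  fixes \<mu> :: "real \<Rightarrow> 'a::real_normed_vector \<Rightarrow>\<^sub>L 'b::real_normed_vector"
  assumes \<mu>: "bounded_variation_on \<mu> a b" and \<phi>: "continuous_on {a..b} \<phi>"
  shows "cauchy_filter (filtermap (RS_sum \<mu> \<phi>) (partition_filter a b))"
  unfolding cauchy_filter_metric_filtermap
proof (intro allI impI)
  fix \<epsilon> :: real assume \<epsilon>: "0 < \<epsilon>"
  define V where "V = total_variation \<mu> a b"
  have V_nonneg: "0 \<le> V"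
    unfolding V_def by (rule total_variation_nonneg[OF \<mu>])
  have "uniformly_continuous_on {a..b} \<phi>"
    using \<phi> by (rule compact_uniformly_continuous) simp
  moreover have quotient_pos: "0 < \<epsilon> / (V + 1)"
    using \<epsilon> V_nonneg by simp
  ultimately obtain d where d: "0 < d"
      and osc: "\<And>s s'. s \<in> {a..b} \<Longrightarrow> s' \<in> {a..b} \<Longrightarrow> dist s s' < d \<Longrightarrow> dist (\<phi> s) (\<phi> s') < \<epsilon> / (V + 1)"
    unfolding uniformly_continuous_on_def by meson
  have close: "dist (RS_sum \<mu> \<phi> (xs, ts)) (RS_sum \<mu> \<phi> (ys, us)) < \<epsilon>"
    if "fine_partition a b (d / 2) xs ts" "fine_partition a b (d / 2) ys us" for xs ts ys us
  proof -
    have "dist (RS_sum \<mu> \<phi> (xs, ts)) (RS_sum \<mu> \<phi> (ys, us)) \<le> V * (\<epsilon> / (V + 1))"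
      unfolding dist_norm V_def using quotient_pos osc
      by (intro norm_RS_sum_diff_le[OF \<mu> _ _ that]) (auto simp: dist_norm V_def less_imp_le)
    also have "\<dots> < \<epsilon>"
      using \<epsilon> V_nonneg by (simp add: field_simps)
    finally show ?thesis .
  qed
  show "\<exists>Q. eventually Q (partition_filter a b) \<and>
      (\<forall>P P'. Q P \<and> Q P' \<longrightarrow> dist (RS_sum \<mu> \<phi> P) (RS_sum \<mu> \<phi> P') < \<epsilon>)"
  proof (intro exI conjI)
    show "\<forall>\<^sub>F (xs, ts) in partition_filter a b. fine_partition a b (d / 2) xs ts"
      unfolding eventually_partition_filter using d by (intro exI[of _ "d / 2"]) simp
  qed (use close in auto)
qed

lemma has_RS_integral_exists:
  fixes \<mu> :: "real \<Rightarrow> 'a::banach \<Rightarrow>\<^sub>L 'a"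
  assumes ab: "a \<le> b" and \<mu>: "bounded_variation_on \<mu> a b" and \<phi>: "continuous_on {a..b} \<phi>"
  shows "\<exists>I. has_RS_integral \<mu> \<phi> a b I"
proof -
  have "\<exists>I. filtermap (RS_sum \<mu> \<phi>) (partition_filter a b) \<le> nhds I"
    using cauchy_filter_RS_sum[OF \<mu> \<phi>]
    by (rule cauchy_filter_complete_converges[OF _ complete_UNIV])
      (simp_all add: filtermap_bot_iff partition_filter_neq_bot[OF ab])
  then show ?thesis
    by (simp add: has_RS_integral_iff_tendsto filterlim_def)
qed

section \<open>The delay operator\<close>

lemma delay_op_eq:
  assumes "0 \<le> r" "has_RS_integral \<mu> \<phi> (- r) 0 I"
  shows "delay_op \<mu> r \<phi> = I"
  unfolding delay_op_def using assms has_RS_integral_unique[of "- r" 0]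
  by (intro the_equality) auto

lemma has_RS_integral_delay_op:
  fixes \<mu> :: "real \<Rightarrow> 'a::banach \<Rightarrow>\<^sub>L 'a"
  assumes "0 \<le> r" "bounded_variation_on \<mu> (- r) 0" "continuous_on {- r..0} \<phi>"
  shows "has_RS_integral \<mu> \<phi> (- r) 0 (delay_op \<mu> r \<phi>)"
  using has_RS_integral_exists[of "- r" 0 \<mu> \<phi>] delay_op_eq assms by fastforce

lemma
  fixes \<mu> :: "real \<Rightarrow> 'a::banach \<Rightarrow>\<^sub>L 'a"
  assumes r: "0 \<le> r" and \<mu>: "bounded_variation_on \<mu> (- r) 0"
    and \<phi>: "continuous_on {- r..0} \<phi>" and \<psi>: "continuous_on {- r..0} \<psi>"
  shows delay_op_add: "delay_op \<mu> r (\<lambda>t. \<phi> t + \<psi> t) = delay_op \<mu> r \<phi> + delay_op \<mu> r \<psi>"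
    and delay_op_diff: "delay_op \<mu> r (\<lambda>t. \<phi> t - \<psi> t) = delay_op \<mu> r \<phi> - delay_op \<mu> r \<psi>"
proof -
  note lim = has_RS_integral_delay_op[OF r \<mu> \<phi>, unfolded has_RS_integral_iff_tendsto]
    has_RS_integral_delay_op[OF r \<mu> \<psi>, unfolded has_RS_integral_iff_tendsto]
  show "delay_op \<mu> r (\<lambda>t. \<phi> t + \<psi> t) = delay_op \<mu> r \<phi> + delay_op \<mu> r \<psi>"
    using tendsto_add[OF lim]
    by (intro delay_op_eq[OF r]) (simp add: has_RS_integral_iff_tendsto RS_sum_add)
  show "delay_op \<mu> r (\<lambda>t. \<phi> t - \<psi> t) = delay_op \<mu> r \<phi> - delay_op \<mu> r \<psi>"
    using tendsto_diff[OF lim]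
    by (intro delay_op_eq[OF r]) (simp add: has_RS_integral_iff_tendsto RS_sum_diff)
qed

lemma norm_delay_op_le:
  fixes \<mu> :: "real \<Rightarrow> 'a::banach \<Rightarrow>\<^sub>L 'a"
  assumes "0 \<le> r" "bounded_variation_on \<mu> (- r) 0" "continuous_on {- r..0} \<phi>"
    and "\<And>t. t \<in> {- r..0} \<Longrightarrow> norm (\<phi> t) \<le> B"
  shows "norm (delay_op \<mu> r \<phi>) \<le> total_variation \<mu> (- r) 0 * B"
  using assms by (intro has_RS_integral_norm_le[OF _ assms(2) has_RS_integral_delay_op[OF assms(1-3)]]) auto

section \<open>The Sobolev spaces \<open>W\<^sup>1\<^sup>,\<^sup>p\<close> on intervals\<close>

lemma W1p_has_integral:
  fixes h g :: "real \<Rightarrow> 'b::banach"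
  assumes W: "W1p p a S h g" and "c \<in> S" "d \<in> S" "a \<le> c" "c \<le> d"
  shows "(g has_integral (h d - h c)) {c..d}"
proof -
  have to_c: "(g has_integral (h c - h a)) {a..c}" and to_d: "(g has_integral (h d - h a)) {a..d}"
    using W assms(2,3) by (auto simp: W1p_def)
  have "g integrable_on {c..d}"
    using has_integral_integrable[OF to_d] by (rule integrable_subinterval_real) (use assms(4) in auto)
  moreover have "integral {a..c} g + integral {c..d} g = integral {a..d} g"
    using assms(4,5) has_integral_integrable[OF to_d]
    by (rule Henstock_Kurzweil_Integration.integral_combine)
  then have "integral {c..d} g = h d - h c"
    using integral_unique[OF to_c] integral_unique[OF to_d] by (simp add: algebra_simps)
  ultimately show ?thesis
    by (simp add: has_integral_integrable_integral)
qed

lemma W1p_continuous_on_Icc: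
  fixes h g :: "real \<Rightarrow> 'b::banach"
  assumes W: "W1p p a S h g" and ab: "{a..b} \<subseteq> S"
  shows "continuous_on {a..b} h"
proof (cases "a \<le> b")
  case True
  then have "g integrable_on {a..b}"
    using ab by (intro has_integral_integrable[OF W1p_has_integral[OF W]]) auto
  then have "continuous_on {a..b} (\<lambda>t. h a + integral {a..t} g)"
    by (intro continuous_intros indefinite_integral_continuous_1)
  moreover have "h a + integral {a..t} g = h t" if "t \<in> {a..b}" for t
    using integral_unique[OF W1p_has_integral[OF W, of a t]] that subsetD[OF ab, of a] subsetD[OF ab, of t]
    by auto
  ultimately show ?thesis
    by (rule continuous_on_eq)
qed simp

lemma W1p_continuous_on_atLeast:
  fixes h g :: "real \<Rightarrow> 'b::banach"
  assumes "W1p p a {a..} h g"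
  shows "continuous_on {a..} h"
  unfolding continuous_on_eq_continuous_within
proof
  fix t assume t: "t \<in> {a..}"
  have "continuous_on {a..t + 1} h"
    by (rule W1p_continuous_on_Icc[OF assms]) auto
  then have "continuous (at t within {a..t + 1}) h"
    using t by (simp add: continuous_on_eq_continuous_within)
  moreover have "at t within {a..t + 1} = at t within {a..}"
    by (rule at_within_nhd[of _ "{t - 1<..<t + 1}"]) auto
  ultimately show "continuous (at t within {a..}) h" by simp
qed

lemma W1p_add:
  assumes "0 \<le> p" "S \<in> sets lebesgue" "W1p p a S h g" "W1p p a S h' g'"
  shows "W1p p a S (\<lambda>t. h t + h' t) (\<lambda>t. g t + g' t)"
  unfolding W1p_def
proof (intro conjI ballI)
  fix t assume "t \<in> S"
  then have "((\<lambda>t. g t + g' t) has_integral ((h t - h a) + (h' t - h' a))) {a..t}"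
    using assms by (intro has_integral_add) (auto simp: W1p_def)
  then show "((\<lambda>t. g t + g' t) has_integral (h t + h' t - (h a + h' a))) {a..t}"
    by (simp add: algebra_simps)
qed (use assms in \<open>auto simp: W1p_def intro: Lp_add\<close>)

lemma W1p_restrict:
  fixes h g :: "real \<Rightarrow> 'b::banach"
  assumes W: "W1p p a S h g" and c: "c \<in> S" "a \<le> c" and S': "S' \<subseteq> S \<inter> {c..}"
    and S: "S \<in> sets lebesgue" "S' \<in> sets lebesgue"
  shows "W1p p c S' h g"
  using W S' S W1p_has_integral[OF W c(1) _ c(2)] unfolding W1p_def
  by (auto intro: Lp_subset)

lemma W1p_translate:
  assumes W: "W1p p a S h g" and S: "S \<in> sets lebesgue"
  shows "W1p p (a - c) {t. t + c \<in> S} (\<lambda>t. h (t + c)) (\<lambda>t. g (t + c))"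
  unfolding W1p_def
proof (intro conjI ballI)
  show "Lp p {t. t + c \<in> S} (\<lambda>t. h (t + c))" "Lp p {t. t + c \<in> S} (\<lambda>t. g (t + c))"
    using W S by (auto simp: W1p_def intro: Lp_translate)
  fix t assume "t \<in> {t. t + c \<in> S}"
  then have "(g has_integral h (t + c) - h a) {a - c + c..t + c}"
    using W by (auto simp: W1p_def)
  then have "((g \<circ> (+) c) has_integral h (t + c) - h a) {a - c..t}"
    by (simp only: has_integral_shift_Icc_real)
  then show "((\<lambda>t. g (t + c)) has_integral h (t + c) - h (a - c + c)) {a - c..t}"
    by (simp add: comp_def add.commute)
qed

section \<open>Complex Banach spaces\<close>

lemma has_vector_derivative_exp_shift:
  "((\<lambda>s. exp (z * complex_of_real (s - c))) has_vector_derivative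
    z * exp (z * complex_of_real (t - c))) (at t within S)"
proof -
  have "((\<lambda>w. exp (z * (w - of_real c))) has_field_derivative z * exp (z * (of_real t - of_real c)))
      (at (complex_of_real t))"
    by (auto intro!: derivative_eq_intros)
  from has_vector_derivative_real_field[OF this] show ?thesis
    by simp
qed

locale complex_banach =
  fixes sm :: "complex \<Rightarrow> 'a::banach \<Rightarrow> 'a"
  assumes smul: "complex_banach_smul sm"
begin

lemma sm_sm: "sm c (sm d x) = sm (c * d) x"
  and sm_of_real: "sm (complex_of_real s) x = s *\<^sub>R x"
  and norm_sm: "norm (sm c x) = cmod c * norm x"
  using smul by (auto simp: complex_banach_smul_def)

lemma sm_one [simp]: "sm 1 x = x"
  using sm_of_real[of 1 x] by simp

sublocale sm: bounded_bilinear sm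
proof
  show "sm (c + d) x = sm c x + sm d x" "sm c (x + y) = sm c x + sm c y" for c d x y
    using smul by (auto simp: complex_banach_smul_def)
  show "sm (s *\<^sub>R c) x = s *\<^sub>R sm c x" "sm c (s *\<^sub>R x) = s *\<^sub>R sm c x" for s c x
    by (simp_all add: sm_of_real[symmetric] sm_sm scaleR_conv_of_real mult.commute)
  show "\<exists>K. \<forall>c x. norm (sm c x) \<le> norm c * norm x * K"
    by (intro exI[of _ 1]) (simp add: norm_sm)
qed

lemma Lp_sm:
  assumes "0 \<le> p" "S \<in> sets lebesgue" "Lp p S f"
  shows "Lp p S (\<lambda>t. sm c (f t))"
  by (rule Lp_compose[OF assms, of _ "cmod c"])
    (auto simp: norm_sm intro!: sm.continuous_on continuous_intros)

lemma Lp_sm_const: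
  assumes "0 \<le> p" "S \<in> sets lebesgue" "Lp p S a"
  shows "Lp p S (\<lambda>t. sm (a t) w)"
  by (rule Lp_compose[OF assms, of "\<lambda>c. sm c w" "norm w"])
    (auto simp: norm_sm intro!: sm.continuous_on continuous_intros)

lemma exp_fun_zero [simp]: "exp_fun sm lam x 0 = x"
  by (simp add: exp_fun_def)

lemma norm_exp_fun: "norm (exp_fun sm lam x \<theta>) = exp (Re lam * \<theta>) * norm x"
  by (simp add: exp_fun_def norm_sm)

lemma norm_exp_fun_le:
  assumes "0 \<le> Re lam" "\<theta> \<le> 0"
  shows "norm (exp_fun sm lam x \<theta>) \<le> norm x"
proof -
  have "exp (Re lam * \<theta>) \<le> 1"
    using assms by (simp add: mult_nonneg_nonpos)
  then show ?thesis
    unfolding norm_exp_fun by (intro mult_left_le_one_le) auto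
qed

lemma exp_fun_has_vector_derivative:
  "(exp_fun sm lam x has_vector_derivative sm lam (exp_fun sm lam x t)) (at t within S)"
  using sm.has_vector_derivative[OF has_vector_derivative_exp_shift[of lam 0] has_vector_derivative_const]
  by (simp add: exp_fun_def[abs_def] sm_sm sm.zero_right)

lemma continuous_on_exp_fun: "continuous_on S (exp_fun sm lam x)"
  by (rule continuous_on_vector_derivative[OF exp_fun_has_vector_derivative])

lemma W1p_exp_fun:
  assumes p: "0 \<le> p"
  shows "W1p p a {a..b} (exp_fun sm lam x) (\<lambda>\<theta>. sm lam (exp_fun sm lam x \<theta>))"
proof -
  have "Lp p {a..b} (\<lambda>\<theta>. exp (lam * complex_of_real \<theta>))"
    by (intro Lp_continuous_on_Icc p continuous_intros)
  then have Lp_exp: "Lp p {a..b} (exp_fun sm lam x)"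
    unfolding exp_fun_def using p by (intro Lp_sm_const) auto
  moreover have "Lp p {a..b} (\<lambda>\<theta>. sm lam (exp_fun sm lam x \<theta>))"
    using p Lp_exp by (intro Lp_sm) auto
  ultimately show ?thesis
    unfolding W1p_def by (auto intro: fundamental_theorem_of_calculus exp_fun_has_vector_derivative)
qed

end

section \<open>Variation of constants\<close>

lemma has_integral_linear_exp_decay:
  fixes \<gamma> :: real
  assumes "0 < \<gamma>" "c \<le> d"
  shows "((\<lambda>s. (1 + (s - c)) * exp (- \<gamma> * (s - c))) has_integral
    ((1 + 1 / \<gamma>) / \<gamma> - (1 + (d - c) + 1 / \<gamma>) * exp (- \<gamma> * (d - c)) / \<gamma>)) {c..d}"
proof -
  define G where "G s = - ((1 + (s - c) + 1 / \<gamma>) * exp (- \<gamma> * (s - c)) / \<gamma>)" for s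
  have "(G has_real_derivative (1 + (s - c)) * exp (- \<gamma> * (s - c))) (at s within {c..d})" for s
    unfolding G_def using assms(1) by (auto intro!: derivative_eq_intros simp: field_simps)
  then have "((\<lambda>s. (1 + (s - c)) * exp (- \<gamma> * (s - c))) has_integral G d - G c) {c..d}"
    using assms(2) by (intro fundamental_theorem_of_calculus)
      (auto simp: has_real_derivative_iff_has_vector_derivative)
  then show ?thesis
    by (simp add: G_def)
qed

lemma linear_exp_decay_le:
  fixes \<gamma> u :: real
  assumes "0 < \<gamma>" "0 \<le> u"
  shows "(1 + u) * exp (- \<gamma> * u) \<le> 1 + 1 / \<gamma>"
proof -
  have "1 + u \<le> (1 + 1 / \<gamma>) * (1 + \<gamma> * u)"
    using assms by (simp add: field_simps)
  also have "\<dots> \<le> (1 + 1 / \<gamma>) * exp (\<gamma> * u)"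
    using assms by (intro mult_left_mono exp_ge_add_one_self) auto
  finally show ?thesis
    by (simp add: exp_minus field_simps)
qed

lemma has_integral_diff_weak_derivative:
  fixes h g j :: "real \<Rightarrow> 'b::banach"
  assumes W: "W1p p c {c..d} h g" and j: "continuous_on {c..d} j" and t: "t \<in> {c..d}"
  shows "((\<lambda>s. j s - g s) has_integral integral {c..t} j - (h t - h c)) {c..t}"
proof (rule has_integral_diff)
  show "(j has_integral integral {c..t} j) {c..t}"
    using t by (intro integrable_integral integrable_continuous_real continuous_on_subset[OF j]) auto
  show "(g has_integral (h t - h c)) {c..t}"
    using W t by (simp add: W1p_def)
qed

definition boundary_const :: "complex \<Rightarrow> real" where
  "boundary_const lam = (1 + 1 / Re lam) * (1 + cmod lam / Re lam)"

lemma boundary_const_nonneg: "0 < Re lam \<Longrightarrow> 0 \<le> boundary_const lam"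
  by (simp add: boundary_const_def)

context complex_banach
begin

text \<open>Since \<open>f\<close> is merely integrable, \<open>exp (- lam s) f s\<close> is avoided: adding the primitive \<open>F\<close> of
  \<open>f\<close> to \<open>h\<close> gives a continuously differentiable function, whatever the regularity of \<open>h'\<close>.\<close>

lemma variation_of_constants:
  fixes h g q :: "real \<Rightarrow> 'a" and lam :: complex
  assumes W: "W1p p c {c..d} h g" and q: "continuous_on {c..d} q" and cd: "c \<le> d"
  defines "f \<equiv> \<lambda>t. sm lam (h t) - g t - q t"
  defines "F \<equiv> \<lambda>t. integral {c..t} f"
  shows "f integrable_on {c..d}"
    and "((\<lambda>s. exp_fun sm (- lam) (sm lam (F s) + q s) (s - c)) has_integral
      h c - exp_fun sm (- lam) (h d + F d) (d - c)) {c..d}"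
proof -
  define j where "j t = sm lam (h t) - q t" for t
  have j: "continuous_on {c..d} j"
    unfolding j_def
    by (intro continuous_intros sm.continuous_on W1p_continuous_on_Icc[OF W] q) simp
  have f_eq: "f = (\<lambda>t. j t - g t)"
    by (auto simp: f_def j_def algebra_simps)
  note f_integral = has_integral_diff_weak_derivative[OF W j, folded f_eq]
  show "f integrable_on {c..d}"
    using f_integral[of d] cd by (auto intro: has_integral_integrable)
  have primitive: "h t + F t = h c + integral {c..t} j" if "t \<in> {c..d}" for t
    using integral_unique[OF f_integral[OF that]] by (simp add: F_def)
  define E where "E s = exp (- lam * complex_of_real (s - c))" for s
  have E: "(E has_vector_derivative - lam * E s) (at s within {c..d})" for s
    unfolding E_def by (rule has_vector_derivative_exp_shift)
  have deriv: "((\<lambda>s. - sm (E s) (h s + F s)) has_vector_derivative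
      exp_fun sm (- lam) (sm lam (F s) + q s) (s - c)) (at s within {c..d})" if s: "s \<in> {c..d}" for s
  proof -
    have "((\<lambda>s. h c + integral {c..s} j) has_vector_derivative j s) (at s within {c..d})"
      using has_vector_derivative_add[OF has_vector_derivative_const integral_has_vector_derivative[OF j s]]
      by simp
    then have "((\<lambda>s. h s + F s) has_vector_derivative j s) (at s within {c..d})"
      by (rule has_vector_derivative_transform[rotated 2]) (use s primitive in auto)
    from has_vector_derivative_minus[OF sm.has_vector_derivative[OF E this]] show ?thesis
      by (simp add: j_def exp_fun_def E_def sm.add_right sm.diff_right sm.minus_left sm_sm mult.commute)
  qed
  have "F c = 0"
    by (simp add: F_def)
  then show "((\<lambda>s. exp_fun sm (- lam) (sm lam (F s) + q s) (s - c)) has_integral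
      h c - exp_fun sm (- lam) (h d + F d) (d - c)) {c..d}"
    using fundamental_theorem_of_calculus[OF cd deriv] by (simp add: E_def exp_fun_def)
qed

lemma norm_exp_decay_le:
  assumes "0 < Re lam" and "0 \<le> u" and x: "norm x \<le> (1 + u) * B" and "0 \<le> B"
  shows "norm (exp_fun sm (- lam) x u) \<le> (1 + 1 / Re lam) * B"
proof -
  have "norm (exp_fun sm (- lam) x u) \<le> exp (- Re lam * u) * ((1 + u) * B)"
    unfolding norm_exp_fun using x by simp
  also have "\<dots> = (1 + u) * exp (- Re lam * u) * B"
    by simp
  also have "\<dots> \<le> (1 + 1 / Re lam) * B"
    using assms by (intro mult_right_mono linear_exp_decay_le) auto
  finally show ?thesis .
qed

lemma norm_integral_exp_decay_le:
  assumes lam: "0 < Re lam" and cd: "c \<le> d" and B: "0 \<le> B"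
    and I: "((\<lambda>s. exp_fun sm (- lam) (F s) (s - c)) has_integral I) {c..d}"
    and F: "\<And>s. s \<in> {c..d} \<Longrightarrow> norm (F s) \<le> (1 + (s - c)) * B"
  shows "norm I \<le> (1 + 1 / Re lam) / Re lam * B"
proof -
  let ?J = "(1 + 1 / Re lam) / Re lam - (1 + (d - c) + 1 / Re lam) * exp (- Re lam * (d - c)) / Re lam"
  have J: "((\<lambda>s. (1 + (s - c)) * exp (- Re lam * (s - c)) * B) has_integral ?J * B) {c..d}"
    by (intro has_integral_mult_left has_integral_linear_exp_decay lam cd)
  have "norm (exp_fun sm (- lam) (F s) (s - c)) \<le> (1 + (s - c)) * exp (- Re lam * (s - c)) * B"
    if "s \<in> {c..d}" for s
    unfolding norm_exp_fun using mult_left_mono[OF F[OF that], of "exp (- Re lam * (s - c))"]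
    by (simp add: mult_ac)
  then have "norm (integral {c..d} (\<lambda>s. exp_fun sm (- lam) (F s) (s - c))) \<le>
      integral {c..d} (\<lambda>s. (1 + (s - c)) * exp (- Re lam * (s - c)) * B)"
    using I J by (intro Henstock_Kurzweil_Integration.integral_norm_bound_integral)
      (auto intro: has_integral_integrable)
  then have "norm I \<le> ?J * B"
    by (simp only: integral_unique[OF I] integral_unique[OF J])
  also have "\<dots> \<le> (1 + 1 / Re lam) / Re lam * B"
    using lam cd B by (intro mult_right_mono) (auto intro!: divide_nonneg_nonneg mult_nonneg_nonneg)
  finally show ?thesis .
qed

lemma boundary_value_estimate:
  fixes h g q :: "real \<Rightarrow> 'a"
  assumes p: "1 \<le> p" and lam: "0 < Re lam" and W: "W1p p c {c..d} h g"
    and q: "continuous_on {c..d} q" "Lp p {c..d} q" and cd: "c \<le> d"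
  shows "norm (h c - exp_fun sm (- lam) (h d) (d - c) -
      integral {c..d} (\<lambda>s. exp_fun sm (- lam) (q s) (s - c))) \<le>
    boundary_const lam * Lp_norm p {c..d} (\<lambda>t. sm lam (h t) - g t - q t)"
proof -
  define f where "f t = sm lam (h t) - g t - q t" for t
  define N where "N = Lp_norm p {c..d} f"
  define F where "F t = integral {c..t} f" for t
  note primitive = variation_of_constants[OF W q(1) cd, of lam, folded f_def F_def]
  have "Lp p {c..d} f"
    unfolding f_def using W p q(2) by (intro Lp_diff Lp_sm) (auto simp: W1p_def)
  then have F_le: "norm (F t) \<le> (1 + (t - c)) * N" if "t \<in> {c..d}" for t
    unfolding F_def N_def using p that by (intro norm_primitive_le_Lp_norm primitive(1))
  let ?Q = "integral {c..d} (\<lambda>s. exp_fun sm (- lam) (q s) (s - c))"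
  have "((\<lambda>s. exp_fun sm (- lam) (q s) (s - c)) has_integral ?Q) {c..d}"
    unfolding exp_fun_def
    by (intro integrable_integral integrable_continuous_real sm.continuous_on continuous_intros q)
  from has_integral_diff[OF primitive(2) this]
  have "((\<lambda>s. exp_fun sm (- lam) (sm lam (F s)) (s - c)) has_integral
      h c - exp_fun sm (- lam) (h d + F d) (d - c) - ?Q) {c..d}"
    by (simp add: exp_fun_def sm.add_right)
  moreover have "norm (sm lam (F s)) \<le> (1 + (s - c)) * (cmod lam * N)" if "s \<in> {c..d}" for s
    using mult_left_mono[OF F_le[OF that], of "cmod lam"] by (simp add: norm_sm mult_ac)
  ultimately have interior: "norm (h c - exp_fun sm (- lam) (h d + F d) (d - c) - ?Q) \<le>
      (1 + 1 / Re lam) / Re lam * (cmod lam * N)"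
    by (intro norm_integral_exp_decay_le[OF lam cd]) (simp_all add: N_def)
  have endpoint: "norm (exp_fun sm (- lam) (F d) (d - c)) \<le> (1 + 1 / Re lam) * N"
    using F_le[of d] cd by (intro norm_exp_decay_le lam) (simp_all add: N_def)
  have "h c - exp_fun sm (- lam) (h d) (d - c) - ?Q =
      (h c - exp_fun sm (- lam) (h d + F d) (d - c) - ?Q) + exp_fun sm (- lam) (F d) (d - c)"
    by (simp add: exp_fun_def sm.add_right)
  also have "norm \<dots> \<le> (1 + 1 / Re lam) / Re lam * (cmod lam * N) + (1 + 1 / Re lam) * N"
    by (rule norm_triangle_mono[OF interior endpoint])
  also have "\<dots> = boundary_const lam * N"
    by (simp add: boundary_const_def algebra_simps add_divide_distrib)
  finally show ?thesis
    by (simp add: N_def f_def[abs_def])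
qed

text \<open>With \<open>c = 0\<close>, \<open>d \<rightarrow> \<infinity>\<close> this determines \<open>h 0\<close> on the half line; with \<open>d = 0\<close>, \<open>q = 0\<close> it compares
  \<open>h\<close> on the delay interval with an exponential.\<close>

lemma boundary_value_estimate_superset:
  fixes h g q :: "real \<Rightarrow> 'a"
  assumes p: "1 \<le> p" and lam: "0 < Re lam" and W: "W1p p a S h g"
    and q: "continuous_on S q" "Lp p S q" and S: "S \<in> sets lebesgue"
    and cd: "a \<le> c" "c \<le> d" "{c..d} \<subseteq> S"
  shows "norm (h c - exp_fun sm (- lam) (h d) (d - c) -
      integral {c..d} (\<lambda>s. exp_fun sm (- lam) (q s) (s - c))) \<le>
    boundary_const lam * Lp_norm p S (\<lambda>t. sm lam (h t) - g t - q t)"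
proof -
  have "c \<in> S"
    using cd by auto
  then have "W1p p c {c..d} h g"
    using cd(1,3) S by (intro W1p_restrict[OF W]) auto
  moreover have "continuous_on {c..d} q" "Lp p {c..d} q"
    using q cd(3) S by (auto intro: continuous_on_subset Lp_subset)
  ultimately have "norm (h c - exp_fun sm (- lam) (h d) (d - c) -
      integral {c..d} (\<lambda>s. exp_fun sm (- lam) (q s) (s - c))) \<le>
    boundary_const lam * Lp_norm p {c..d} (\<lambda>t. sm lam (h t) - g t - q t)"
    by (intro boundary_value_estimate p lam cd(2))
  also have "\<dots> \<le> boundary_const lam * Lp_norm p S (\<lambda>t. sm lam (h t) - g t - q t)"
  proof -
    have "Lp p S (\<lambda>t. sm lam (h t) - g t - q t)"
      using W p q(2) S by (intro Lp_diff Lp_sm) (auto simp: W1p_def)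
    then show ?thesis
      using p cd(3) by (intro mult_left_mono Lp_norm_mono_set boundary_const_nonneg lam) auto
  qed
  finally show ?thesis .
qed

end

section \<open>The half line and the delay interval\<close>

lemma set_integrable_laplace:
  fixes a :: "real \<Rightarrow> complex"
  assumes p: "1 \<le> p" and lam: "0 < Re lam" and a: "continuous_on {0..} a" "Lp p {0..} a"
  shows "set_integrable lborel {0..} (\<lambda>t. exp (- lam * complex_of_real t) * a t)"
proof -
  let ?u = "\<lambda>t. exp (- lam * complex_of_real t) * a t"
  have "continuous_on {0..} ?u"
    by (intro continuous_intros a)
  then have borel: "set_borel_measurable lborel {0..} ?u"
    by (simp add: set_borel_measurable_def borel_measurable_continuous_on_indicator)
  have exp_integrable: "set_integrable lebesgue {0..} (\<lambda>t. exp (- Re lam * t))"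
    by (intro nonnegative_absolutely_integrable_1 integrable_on_exp_minus_to_infinity lam) simp
  have "set_integrable lebesgue {0..} ?u"
  proof (rule set_integrable_bound)
    show "set_integrable lebesgue {0..} (\<lambda>t. exp (- Re lam * t) + norm (a t) powr p)"
      using a(2) by (intro set_integral_add(1)[OF exp_integrable]) (simp add: Lp_iff_set_integrable)
    show "set_borel_measurable lebesgue {0..} ?u"
      using borel unfolding set_borel_measurable_def by (rule measurable_completion)
    have "norm (?u t) \<le> exp (- Re lam * t) + norm (a t) powr p" if "0 \<le> t" for t
    proof -
      have decay: "exp (- Re lam * t) \<le> 1"
        using that lam by simp
      have "norm (?u t) = exp (- Re lam * t) * norm (a t)"
        by (simp add: norm_mult)
      also have "\<dots> \<le> exp (- Re lam * t) * (1 + norm (a t) powr p)"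
        using le_add_powr[OF p zero_less_one norm_ge_zero[of "a t"]] by (intro mult_left_mono) auto
      also have "\<dots> \<le> exp (- Re lam * t) + norm (a t) powr p"
        using mult_right_mono[OF decay, of "norm (a t) powr p"] by (simp add: distrib_left)
      finally show ?thesis .
    qed
    then show "AE t in lebesgue. t \<in> {0..} \<longrightarrow> norm (?u t) \<le> norm (exp (- Re lam * t) + norm (a t) powr p)"
      by (auto intro: order_trans[OF _ abs_ge_self])
  qed
  then show ?thesis
    using borel unfolding set_integrable_def set_borel_measurable_def by (simp add: integrable_completion)
qed

lemma laplace_tendsto:
  fixes a :: "real \<Rightarrow> complex"
  assumes "1 \<le> p" "0 < Re lam" "continuous_on {0..} a" "Lp p {0..} a"
  shows "((\<lambda>T. integral {0..T} (\<lambda>t. exp (- lam * complex_of_real t) * a t)) \<longlongrightarrow> laplace a lam) at_top"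
proof -
  note integrable = set_integrable_laplace[OF assms]
  have "(LINT t:{0..T}|lborel. exp (- lam * complex_of_real t) * a t) =
      integral {0..T} (\<lambda>t. exp (- lam * complex_of_real t) * a t)" for T
    by (intro set_borel_integral_eq_integral(2) set_integrable_subset[OF integrable]) auto
  then show ?thesis
    using tendsto_set_lebesgue_integral_at_top[OF _ integrable] by (simp add: laplace_def)
qed

lemma Lp_frequently_small:
  fixes h :: "real \<Rightarrow> 'b::real_normed_vector"
  assumes p: "0 < p" and h: "Lp p {b..} h" and \<epsilon>: "0 < \<epsilon>"
  shows "\<exists>\<^sub>F t in at_top. norm (h t) \<le> \<epsilon>"
proof (rule ccontr)
  assume "\<not> ?thesis"
  then obtain m where "\<And>t. m \<le> t \<Longrightarrow> \<epsilon> < norm (h t)"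
    by (auto simp: not_frequently eventually_at_top_linorder not_le)
  then have large: "\<epsilon> powr p \<le> norm (h t) powr p" if "max b m \<le> t" for t
    using that p \<epsilon> by (intro powr_mono2) (auto simp: less_imp_le)
  let ?I = "LINT t:{b..}|lebesgue. norm (h t) powr p"
  have "real n * \<epsilon> powr p \<le> ?I" for n
  proof -
    let ?J = "{max b m..max b m + real n}"
    have "real n * \<epsilon> powr p = (LINT t:?J|lebesgue. \<epsilon> powr p)"
      by (simp add: set_integral_const)
    also have "\<dots> \<le> ?I"
      unfolding set_lebesgue_integral_def using h large
      by (intro integral_mono) (auto simp: Lp_iff_set_integrable set_integrable_def split: split_indicator)
    finally show ?thesis .
  qed
  then have "real n \<le> ?I / \<epsilon> powr p" for n
    using \<epsilon> by (simp add: field_simps)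
  then show False
    using reals_Archimedean2 not_less by metis
qed

context complex_banach
begin

lemma delay_boundary_value:
  assumes p: "1 \<le> p" and lam: "0 < Re lam" and W: "W1p p a {a..b} \<phi> \<psi>" and \<theta>: "\<theta> \<in> {a..b}"
  shows "norm (\<phi> \<theta> - exp_fun sm lam (\<phi> b) (\<theta> - b)) \<le>
    boundary_const lam * Lp_norm p {a..b} (\<lambda>t. sm lam (\<phi> t) - \<psi> t)"
proof -
  have "exp_fun sm (- lam) (\<phi> b) (b - \<theta>) = exp_fun sm lam (\<phi> b) (\<theta> - b)"
    by (simp add: exp_fun_def algebra_simps)
  then show ?thesis
    using boundary_value_estimate_superset[OF p lam W continuous_on_const Lp_zero, of \<theta> b] \<theta>
    by (simp add: exp_fun_def sm.zero_right)
qed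

lemma halfline_boundary_value:
  assumes p: "1 \<le> p" and lam: "0 < Re lam" and W: "W1p p 0 {0..} h g"
    and q: "continuous_on {0..} q" "Lp p {0..} q"
    and J: "((\<lambda>T. integral {0..T} (\<lambda>s. exp_fun sm (- lam) (q s) s)) \<longlongrightarrow> J) at_top"
  shows "norm (h 0 - J) \<le> boundary_const lam * Lp_norm p {0..} (\<lambda>t. sm lam (h t) - g t - q t)"
    (is "_ \<le> ?K")
proof -
  define F where "F = inf at_top (principal {T. norm (h T) \<le> 1})"
  have "F \<noteq> bot"
    using Lp_frequently_small[of p 0 h 1] W p
    by (auto simp: F_def trivial_limit_def eventually_inf_principal frequently_def W1p_def)
  have F_at_top: "F \<le> at_top" and F_small: "\<forall>\<^sub>F T in F. norm (h T) \<le> 1"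
    by (auto simp: F_def eventually_inf_principal)
  have estimate: "norm (h 0 - exp_fun sm (- lam) (h T) T -
      integral {0..T} (\<lambda>s. exp_fun sm (- lam) (q s) s)) \<le> ?K"
    if "0 \<le> T" for T
    using boundary_value_estimate_superset[OF p lam W q, of 0 T] that by simp
  have "((\<lambda>T. exp (- Re lam * T)) \<longlongrightarrow> 0) at_top"
    using lam by (intro filterlim_compose[OF exp_at_bot]
        filterlim_tendsto_neg_mult_at_bot[OF tendsto_const _ filterlim_ident]) simp
  then have exp_tendsto: "((\<lambda>T. exp (- Re lam * T)) \<longlongrightarrow> 0) F"
    by (rule tendsto_mono[OF F_at_top])
  have "((\<lambda>T. exp_fun sm (- lam) (h T) T) \<longlongrightarrow> 0) F"
  proof (rule Lim_null_comparison[OF _ exp_tendsto])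
    show "\<forall>\<^sub>F T in F. norm (exp_fun sm (- lam) (h T) T) \<le> exp (- Re lam * T)"
      using F_small by eventually_elim (simp add: norm_exp_fun)
  qed
  then have "((\<lambda>T. norm (h 0 - exp_fun sm (- lam) (h T) T -
      integral {0..T} (\<lambda>s. exp_fun sm (- lam) (q s) s))) \<longlongrightarrow> norm (h 0 - 0 - J)) F"
    by (intro tendsto_intros tendsto_mono[OF F_at_top J])
  moreover have "\<forall>\<^sub>F T in F. norm (h 0 - exp_fun sm (- lam) (h T) T -
      integral {0..T} (\<lambda>s. exp_fun sm (- lam) (q s) s)) \<le> ?K"
    using filter_leD[OF F_at_top eventually_ge_at_top[of 0]] by eventually_elim (rule estimate)
  ultimately show ?thesis
    using tendsto_upperbound[OF _ _ \<open>F \<noteq> bot\<close>] by fastforce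
qed

lemma halfline_boundary_value_laplace:
  assumes p: "1 \<le> p" and lam: "0 < Re lam" and W: "W1p p 0 {0..} h g"
    and a: "continuous_on {0..} a" "Lp p {0..} a"
  shows "norm (h 0 - sm (laplace a lam) w) \<le>
    boundary_const lam * Lp_norm p {0..} (\<lambda>t. sm lam (h t) - g t - sm (a t) w)"
proof (rule halfline_boundary_value[OF p lam W])
  show "continuous_on {0..} (\<lambda>t. sm (a t) w)"
    by (intro sm.continuous_on continuous_intros a)
  show "Lp p {0..} (\<lambda>t. sm (a t) w)"
    using p a by (intro Lp_sm_const) auto
  have "integral {0..T} (\<lambda>s. exp_fun sm (- lam) (sm (a s) w) s) =
      sm (integral {0..T} (\<lambda>s. exp (- lam * complex_of_real s) * a s)) w" for T
  proof -
    have "continuous_on {0..T} (\<lambda>s. exp (- lam * complex_of_real s) * a s)"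
      by (intro continuous_intros continuous_on_subset[OF a(1)]) auto
    from integral_linear[OF integrable_continuous_real[OF this] sm.bounded_linear_left[of w]]
    show ?thesis
      by (simp add: comp_def exp_fun_def sm_sm)
  qed
  then show "((\<lambda>T. integral {0..T} (\<lambda>s. exp_fun sm (- lam) (sm (a s) w) s)) \<longlongrightarrow> sm (laplace a lam) w) at_top"
    using sm.tendsto[OF laplace_tendsto[OF p lam a] tendsto_const] by simp
qed

end

section \<open>Solving the resolvent equations\<close>

context complex_banach
begin

lemma A_zero_solve:
  assumes p: "0 \<le> p" and zero: "in_resolvent_X0 sm p (A_zero p D A) lam" and f: "Lp p {0..} f"
  obtains h g where "W1p p 0 {0..} h g" "AE t in lebesgue. t \<in> {0..} \<longrightarrow> sm lam (h t) - g t = f t"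
proof -
  obtain h g where W: "W1p p 0 {0..} h g"
      and norm_zero: "Lp_norm p {0..} (\<lambda>t. sm lam (h t) - g t - f t) = 0"
    using zero f unfolding in_resolvent_X0_def A_zero_def by fastforce
  have "Lp p {0..} (\<lambda>t. sm lam (h t) - g t - f t)"
    using W p f by (intro Lp_diff Lp_sm) (auto simp: W1p_def)
  with norm_zero have "AE t in lebesgue. t \<in> {0..} \<longrightarrow> sm lam (h t) - g t = f t"
    by (subst (asm) Lp_norm_eq_0_iff) auto
  with W show ?thesis
    by (rule that)
qed

text \<open>Surjectivity of \<open>lam - \<A>\<^sub>0\<close> also solves the equation on the delay interval: shift the right-hand
  side to the half line. This replaces the Bochner integral of a right-hand side in \<open>L\<^sup>p\<close>.\<close>

lemma delay_solve:
  assumes p: "0 \<le> p" and r: "0 \<le> r" and zero: "in_resolvent_X0 sm p (A_zero p D A) lam"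
    and \<eta>: "Lp p {- r..0} \<eta>"
  obtains \<phi> \<psi> where "W1p p (- r) {- r..0} \<phi> \<psi>" "\<phi> 0 = x"
    "AE t in lebesgue. t \<in> {- r..0} \<longrightarrow> sm lam (\<phi> t) - \<psi> t = \<eta> t"
proof -
  define \<eta>\<^sub>0 where "\<eta>\<^sub>0 t = (if t \<in> {- r..0} then \<eta> t else 0)" for t
  have "Lp p UNIV \<eta>\<^sub>0"
    unfolding \<eta>\<^sub>0_def using \<eta> by (intro Lp_extend_by_zero) auto
  from Lp_translate[OF this, of "- r"] have "Lp p {0..} (\<lambda>t. \<eta>\<^sub>0 (t - r))"
    by (auto intro: Lp_subset)
  then obtain h g where W: "W1p p 0 {0..} h g"
      and solution: "AE t in lebesgue. t \<in> {0..} \<longrightarrow> sm lam (h t) - g t = \<eta>\<^sub>0 (t - r)"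
    by (rule A_zero_solve[OF p zero])
  have "{t. t + r \<in> {0..}} = {- r..}"
    by auto
  then have "W1p p (- r) {- r..} (\<lambda>t. h (t + r)) (\<lambda>t. g (t + r))"
    using W1p_translate[OF W, of r] by simp
  then have shifted: "W1p p (- r) {- r..0} (\<lambda>t. h (t + r)) (\<lambda>t. g (t + r))"
    by (rule W1p_restrict) auto
  let ?e = "exp_fun sm lam (x - h r)"
  show ?thesis
  proof
    show "W1p p (- r) {- r..0} (\<lambda>t. h (t + r) + ?e t) (\<lambda>t. g (t + r) + sm lam (?e t))"
      using p by (intro W1p_add shifted W1p_exp_fun) auto
    show "h (0 + r) + ?e 0 = x"
      by simp
    show "AE t in lebesgue. t \<in> {- r..0} \<longrightarrow> sm lam (h (t + r) + ?e t) - (g (t + r) + sm lam (?e t)) = \<eta> t"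
      using AE_lebesgue_translate[OF solution, of r]
      by eventually_elim (auto simp: \<eta>\<^sub>0_def sm.add_right)
  qed
qed

end

section \<open>The characteristic operator\<close>

locale volterra_delay_equation = complex_banach sm
  for sm :: "complex \<Rightarrow> 'a::banach \<Rightarrow> 'a" +
  fixes p r :: real and D :: "'a set" and A :: "'a \<Rightarrow> 'a" and a :: "real \<Rightarrow> complex"
    and \<mu> :: "real \<Rightarrow> 'a \<Rightarrow>\<^sub>L 'a" and lam :: complex
  assumes p_ge_1: "1 \<le> p" and r_nonneg: "0 \<le> r" and Re_lam_pos: "0 < Re lam"
    and a_continuous: "continuous_on {0..} a" and a_Lp: "Lp p {0..} a"
    and mu_bv: "bounded_variation_on \<mu> (- r) 0"
begin

lemma p_nonneg: "0 \<le> p"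
  using p_ge_1 by simp

definition char_op :: "'a \<Rightarrow> 'a" where
  "char_op x = sm (1 + laplace a lam) (A x) + delay_op \<mu> r (exp_fun sm lam x)"

text \<open>In the following \<open>g\<close> and \<open>\<psi>\<close> are the weak derivatives of \<open>h\<close> and \<open>\<phi>\<close>; the three residuals are the
  components of \<open>(lam - \<AA>\<^sub>L) (x, h, \<phi>)\<close>.\<close>

definition frakA_domain ::
  "'a \<Rightarrow> (real \<Rightarrow> 'a) \<Rightarrow> (real \<Rightarrow> 'a) \<Rightarrow> (real \<Rightarrow> 'a) \<Rightarrow> (real \<Rightarrow> 'a) \<Rightarrow> bool" where
  "frakA_domain x h g \<phi> \<psi> \<longleftrightarrow>
    x \<in> D \<and> W1p p 0 {0..} h g \<and> W1p p (- r) {- r..0} \<phi> \<psi> \<and> \<phi> 0 = x"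

definition head_residual :: "'a \<Rightarrow> (real \<Rightarrow> 'a) \<Rightarrow> (real \<Rightarrow> 'a) \<Rightarrow> 'a" where
  "head_residual x h \<phi> = sm lam x - (A x + h 0 + delay_op \<mu> r \<phi>)"

definition memory_residual :: "'a \<Rightarrow> (real \<Rightarrow> 'a) \<Rightarrow> (real \<Rightarrow> 'a) \<Rightarrow> real \<Rightarrow> 'a" where
  "memory_residual x h g t = sm lam (h t) - (sm (a t) (A x) + g t)"

definition history_residual :: "(real \<Rightarrow> 'a) \<Rightarrow> (real \<Rightarrow> 'a) \<Rightarrow> real \<Rightarrow> 'a" where
  "history_residual \<phi> \<psi> t = sm lam (\<phi> t) - \<psi> t"

definition residual_norm ::
  "'a \<Rightarrow> (real \<Rightarrow> 'a) \<Rightarrow> (real \<Rightarrow> 'a) \<Rightarrow> (real \<Rightarrow> 'a) \<Rightarrow> (real \<Rightarrow> 'a) \<Rightarrow> real" where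
  "residual_norm x h g \<phi> \<psi> = norm (head_residual x h \<phi>) +
    Lp_norm p {0..} (memory_residual x h g) + Lp_norm p {- r..0} (history_residual \<phi> \<psi>)"

lemma in_resolvent_XX_frakA_L_iff:
  "in_resolvent_XX sm p r (frakA_L sm p r D A a \<mu>) lam \<longleftrightarrow>
    (\<forall>y f \<eta>. Lp p {0..} f \<longrightarrow> Lp p {- r..0} \<eta> \<longrightarrow>
      (\<exists>x h g \<phi> \<psi>. frakA_domain x h g \<phi> \<psi> \<and> head_residual x h \<phi> = y \<and>
        Lp_norm p {0..} (\<lambda>t. memory_residual x h g t - f t) = 0 \<and>
        Lp_norm p {- r..0} (\<lambda>t. history_residual \<phi> \<psi> t - \<eta> t) = 0)) \<and>
    (\<exists>C. \<forall>x h g \<phi> \<psi>. frakA_domain x h g \<phi> \<psi> \<longrightarrow>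
      norm x + Lp_norm p {0..} h + Lp_norm p {- r..0} \<phi> \<le> C * residual_norm x h g \<phi> \<psi>)"
proof -
  let ?G = "frakA_L sm p r D A a \<mu>"
  let ?u = "\<lambda>x h g \<phi> \<psi>.
    ((x, h, \<phi>), (A x + h 0 + delay_op \<mu> r \<phi>, \<lambda>t. sm (a t) (A x) + g t, \<psi>))"
  have Bex_frakA_L: "(\<exists>u\<in>?G. P u) \<longleftrightarrow> (\<exists>x h g \<phi> \<psi>. frakA_domain x h g \<phi> \<psi> \<and> P (?u x h g \<phi> \<psi>))"
    and Ball_frakA_L: "(\<forall>u\<in>?G. P u) \<longleftrightarrow> (\<forall>x h g \<phi> \<psi>. frakA_domain x h g \<phi> \<psi> \<longrightarrow> P (?u x h g \<phi> \<psi>))" for P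
    unfolding frakA_L_def frakA_domain_def by blast+
  show ?thesis
    unfolding in_resolvent_XX_def Bex_frakA_L Ball_frakA_L
    by (simp add: head_residual_def memory_residual_def[abs_def] history_residual_def[abs_def]
        residual_norm_def)
qed

lemma A_delta0_memory_bound:
  assumes "in_resolvent_X0 sm p (A_delta0 sm p D A a) lam"
  obtains C where "0 \<le> C" and "\<And>x h g. x \<in> D \<Longrightarrow> W1p p 0 {0..} h g \<Longrightarrow>
    Lp_norm p {0..} h \<le> C * (norm (sm lam x - (A x + h 0)) + Lp_norm p {0..} (memory_residual x h g))"
proof -
  obtain C where bounded_below: "\<And>x h v k. ((x, h), (v, k)) \<in> A_delta0 sm p D A a \<Longrightarrow>
      norm x + Lp_norm p {0..} h \<le> C * (norm (sm lam x - v) + Lp_norm p {0..} (\<lambda>t. sm lam (h t) - k t))"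
    using assms unfolding in_resolvent_X0_def by fast
  have "Lp_norm p {0..} h \<le>
      \<bar>C\<bar> * (norm (sm lam x - (A x + h 0)) + Lp_norm p {0..} (memory_residual x h g))"
    if x: "x \<in> D" and W: "W1p p 0 {0..} h g" for x h g
  proof -
    let ?R = "norm (sm lam x - (A x + h 0)) + Lp_norm p {0..} (memory_residual x h g)"
    have "((x, h), (A x + h 0, \<lambda>t. sm (a t) (A x) + g t)) \<in> A_delta0 sm p D A a"
      unfolding A_delta0_def using x W by blast
    from bounded_below[OF this] have "norm x + Lp_norm p {0..} h \<le> C * ?R"
      by (simp add: memory_residual_def[abs_def])
    also have "\<dots> \<le> \<bar>C\<bar> * ?R"
      by (intro mult_right_mono) auto
    finally show ?thesis
      using norm_ge_zero[of x] by linarith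
  qed
  then show ?thesis
    by (intro that[of "\<bar>C\<bar>"] abs_ge_zero)
qed

lemma memory_estimate:
  assumes "W1p p 0 {0..} h g"
  shows "norm (h 0 - sm (laplace a lam) (A x)) \<le>
    boundary_const lam * Lp_norm p {0..} (memory_residual x h g)"
  using halfline_boundary_value_laplace[OF p_ge_1 Re_lam_pos assms a_continuous a_Lp, of "A x"]
  by (simp add: memory_residual_def[abs_def] algebra_simps)

lemma history_estimate:
  assumes "W1p p (- r) {- r..0} \<phi> \<psi>" "\<theta> \<in> {- r..0}"
  shows "norm (\<phi> \<theta> - exp_fun sm lam (\<phi> 0) \<theta>) \<le>
    boundary_const lam * Lp_norm p {- r..0} (history_residual \<phi> \<psi>)"
  using delay_boundary_value[OF p_ge_1 Re_lam_pos assms] by (simp add: history_residual_def[abs_def])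

lemma char_op_estimate:
  assumes dom: "frakA_domain x h g \<phi> \<psi>"
  shows "norm (sm lam x - char_op x - head_residual x h \<phi>) \<le>
    boundary_const lam * Lp_norm p {0..} (memory_residual x h g) +
    total_variation \<mu> (- r) 0 * (boundary_const lam * Lp_norm p {- r..0} (history_residual \<phi> \<psi>))"
proof -
  have W: "W1p p 0 {0..} h g" "W1p p (- r) {- r..0} \<phi> \<psi>" and \<phi>0: "\<phi> 0 = x"
    using dom by (auto simp: frakA_domain_def)
  have \<phi>: "continuous_on {- r..0} \<phi>"
    by (rule W1p_continuous_on_Icc[OF W(2)]) simp
  have "sm lam x - char_op x - head_residual x h \<phi> =
      (h 0 - sm (laplace a lam) (A x)) + (delay_op \<mu> r \<phi> - delay_op \<mu> r (exp_fun sm lam x))"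
    by (simp add: char_op_def head_residual_def sm.add_left)
  also have "delay_op \<mu> r \<phi> - delay_op \<mu> r (exp_fun sm lam x) =
      delay_op \<mu> r (\<lambda>\<theta>. \<phi> \<theta> - exp_fun sm lam x \<theta>)"
    by (rule delay_op_diff[OF r_nonneg mu_bv \<phi> continuous_on_exp_fun, symmetric])
  also have "norm (h 0 - sm (laplace a lam) (A x) + delay_op \<mu> r (\<lambda>\<theta>. \<phi> \<theta> - exp_fun sm lam x \<theta>)) \<le>
    boundary_const lam * Lp_norm p {0..} (memory_residual x h g) +
    total_variation \<mu> (- r) 0 * (boundary_const lam * Lp_norm p {- r..0} (history_residual \<phi> \<psi>))"
    using history_estimate[OF W(2)] unfolding \<phi>0
    by (intro norm_triangle_mono memory_estimate W norm_delay_op_le[OF r_nonneg mu_bv] continuous_intros \<phi>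
        continuous_on_exp_fun)
  finally show ?thesis .
qed

lemma exponential_solution:
  assumes zero: "in_resolvent_X0 sm p (A_zero p D A) lam" and x: "x \<in> D"
  obtains h g where "frakA_domain x h g (exp_fun sm lam x) (\<lambda>\<theta>. sm lam (exp_fun sm lam x \<theta>))"
    and "AE t in lebesgue. t \<in> {0..} \<longrightarrow> memory_residual x h g t = 0"
    and "history_residual (exp_fun sm lam x) (\<lambda>\<theta>. sm lam (exp_fun sm lam x \<theta>)) = (\<lambda>\<theta>. 0)"
    and "head_residual x h (exp_fun sm lam x) = sm lam x - char_op x"
proof -
  let ?\<phi> = "exp_fun sm lam x" and ?\<psi> = "\<lambda>\<theta>. sm lam (exp_fun sm lam x \<theta>)"
  have "Lp p {0..} (\<lambda>t. sm (a t) (A x))"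
    by (intro Lp_sm_const p_nonneg a_Lp) simp
  then obtain h g where W: "W1p p 0 {0..} h g"
      and solution: "AE t in lebesgue. t \<in> {0..} \<longrightarrow> sm lam (h t) - g t = sm (a t) (A x)"
    by (rule A_zero_solve[OF p_nonneg zero])
  have dom: "frakA_domain x h g ?\<phi> ?\<psi>"
    unfolding frakA_domain_def using x W by (auto intro: W1p_exp_fun p_nonneg)
  have memory: "AE t in lebesgue. t \<in> {0..} \<longrightarrow> memory_residual x h g t = 0"
    using solution by eventually_elim (auto simp: memory_residual_def algebra_simps)
  have history: "history_residual ?\<phi> ?\<psi> = (\<lambda>\<theta>. 0)"
    by (simp add: history_residual_def[abs_def])
  have "norm (sm lam x - char_op x - head_residual x h ?\<phi>) \<le> 0"
    using char_op_estimate[OF dom] by (simp add: Lp_norm_eq_0I[OF memory] history Lp_norm_eq_0I)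
  with dom memory history show ?thesis
    by (intro that) auto
qed

lemma in_resolvent_X_char_opI:
  assumes zero: "in_resolvent_X0 sm p (A_zero p D A) lam"
    and XX: "in_resolvent_XX sm p r (frakA_L sm p r D A a \<mu>) lam"
  shows "in_resolvent_X sm D char_op lam"
proof -
  have "\<exists>x\<in>D. sm lam x - char_op x = y" for y
  proof -
    obtain x h g \<phi> \<psi> where dom: "frakA_domain x h g \<phi> \<psi>" and head: "head_residual x h \<phi> = y"
        and residuals: "Lp_norm p {0..} (\<lambda>t. memory_residual x h g t - 0) = 0"
          "Lp_norm p {- r..0} (\<lambda>t. history_residual \<phi> \<psi> t - 0) = 0"
      using XX Lp_zero unfolding in_resolvent_XX_frakA_L_iff by blast
    have "norm (sm lam x - char_op x - y) \<le> 0"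
      using char_op_estimate[OF dom] residuals by (simp add: head)
    then show ?thesis
      using dom by (auto simp: frakA_domain_def)
  qed
  moreover obtain C where bounded_below: "\<And>x h g \<phi> \<psi>. frakA_domain x h g \<phi> \<psi> \<Longrightarrow>
      norm x + Lp_norm p {0..} h + Lp_norm p {- r..0} \<phi> \<le> C * residual_norm x h g \<phi> \<psi>"
    using XX unfolding in_resolvent_XX_frakA_L_iff by blast
  have "norm x \<le> C * norm (sm lam x - char_op x)" if x: "x \<in> D" for x
  proof -
    let ?\<phi> = "exp_fun sm lam x"
    obtain h g where dom: "frakA_domain x h g ?\<phi> (\<lambda>\<theta>. sm lam (?\<phi> \<theta>))"
        and residuals: "AE t in lebesgue. t \<in> {0..} \<longrightarrow> memory_residual x h g t = 0"
          "history_residual ?\<phi> (\<lambda>\<theta>. sm lam (?\<phi> \<theta>)) = (\<lambda>\<theta>. 0)"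
          "head_residual x h ?\<phi> = sm lam x - char_op x"
      using exponential_solution[OF zero x] .
    have "norm x + Lp_norm p {0..} h + Lp_norm p {- r..0} ?\<phi> \<le> C * norm (sm lam x - char_op x)"
      using bounded_below[OF dom]
      by (simp add: residual_norm_def residuals(2,3) Lp_norm_eq_0I[OF residuals(1)] Lp_norm_eq_0I)
    then show ?thesis
      using Lp_norm_nonneg[of p "{0..}" h] Lp_norm_nonneg[of p "{- r..0}" ?\<phi>] by linarith
  qed
  ultimately show ?thesis
    unfolding in_resolvent_X_def by blast
qed

lemma frakA_L_solve:
  assumes zero: "in_resolvent_X0 sm p (A_zero p D A) lam"
    and surj: "\<And>y. \<exists>x\<in>D. sm lam x - char_op x = y"
    and f: "Lp p {0..} f" and \<eta>: "Lp p {- r..0} \<eta>"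
  obtains x h g \<phi> \<psi> where "frakA_domain x h g \<phi> \<psi>" "head_residual x h \<phi> = y"
    "Lp_norm p {0..} (\<lambda>t. memory_residual x h g t - f t) = 0"
    "Lp_norm p {- r..0} (\<lambda>t. history_residual \<phi> \<psi> t - \<eta> t) = 0"
proof -
  obtain h\<^sub>f g\<^sub>f where Wf: "W1p p 0 {0..} h\<^sub>f g\<^sub>f"
      and solves_f: "AE t in lebesgue. t \<in> {0..} \<longrightarrow> sm lam (h\<^sub>f t) - g\<^sub>f t = f t"
    using A_zero_solve[OF p_nonneg zero f] .
  obtain \<phi>\<^sub>\<eta> \<psi>\<^sub>\<eta> where W\<eta>: "W1p p (- r) {- r..0} \<phi>\<^sub>\<eta> \<psi>\<^sub>\<eta>" and \<phi>\<^sub>\<eta>_0: "\<phi>\<^sub>\<eta> 0 = 0"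
      and solves_\<eta>: "AE t in lebesgue. t \<in> {- r..0} \<longrightarrow> sm lam (\<phi>\<^sub>\<eta> t) - \<psi>\<^sub>\<eta> t = \<eta> t"
    using delay_solve[OF p_nonneg r_nonneg zero \<eta>] .
  obtain x where x: "x \<in> D" and x_eq: "sm lam x - char_op x = y + h\<^sub>f 0 + delay_op \<mu> r \<phi>\<^sub>\<eta>"
    using surj by blast
  let ?\<phi> = "exp_fun sm lam x" and ?\<psi> = "\<lambda>\<theta>. sm lam (exp_fun sm lam x \<theta>)"
  obtain h g where dom: "frakA_domain x h g ?\<phi> ?\<psi>"
      and memory: "AE t in lebesgue. t \<in> {0..} \<longrightarrow> memory_residual x h g t = 0"
      and head: "head_residual x h ?\<phi> = sm lam x - char_op x"
    by (rule exponential_solution[OF zero x])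
  show ?thesis
  proof
    show "frakA_domain x (\<lambda>t. h t + h\<^sub>f t) (\<lambda>t. g t + g\<^sub>f t) (\<lambda>t. ?\<phi> t + \<phi>\<^sub>\<eta> t) (\<lambda>t. ?\<psi> t + \<psi>\<^sub>\<eta> t)"
      using dom Wf W\<eta> \<phi>\<^sub>\<eta>_0 p_nonneg unfolding frakA_domain_def by (auto intro!: W1p_add)
    have "delay_op \<mu> r (\<lambda>t. ?\<phi> t + \<phi>\<^sub>\<eta> t) = delay_op \<mu> r ?\<phi> + delay_op \<mu> r \<phi>\<^sub>\<eta>"
      by (intro delay_op_add r_nonneg mu_bv continuous_on_exp_fun W1p_continuous_on_Icc[OF W\<eta>]) simp
    then have "head_residual x (\<lambda>t. h t + h\<^sub>f t) (\<lambda>t. ?\<phi> t + \<phi>\<^sub>\<eta> t) =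
        head_residual x h ?\<phi> - h\<^sub>f 0 - delay_op \<mu> r \<phi>\<^sub>\<eta>"
      by (simp add: head_residual_def)
    then show "head_residual x (\<lambda>t. h t + h\<^sub>f t) (\<lambda>t. ?\<phi> t + \<phi>\<^sub>\<eta> t) = y"
      by (simp add: head x_eq)
    show "Lp_norm p {0..} (\<lambda>t. memory_residual x (\<lambda>t. h t + h\<^sub>f t) (\<lambda>t. g t + g\<^sub>f t) t - f t) = 0"
      using memory solves_f by (intro Lp_norm_eq_0I, eventually_elim)
        (auto simp: memory_residual_def sm.add_right algebra_simps)
    show "Lp_norm p {- r..0} (\<lambda>t. history_residual (\<lambda>t. ?\<phi> t + \<phi>\<^sub>\<eta> t) (\<lambda>t. ?\<psi> t + \<psi>\<^sub>\<eta> t) t - \<eta> t) = 0"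
      using solves_\<eta> by (intro Lp_norm_eq_0I, eventually_elim)
        (auto simp: history_residual_def sm.add_right)
  qed
qed

lemma residuals_le_residual_norm:
  "norm (head_residual x h \<phi>) \<le> residual_norm x h g \<phi> \<psi>"
  "Lp_norm p {0..} (memory_residual x h g) \<le> residual_norm x h g \<phi> \<psi>"
  "Lp_norm p {- r..0} (history_residual \<phi> \<psi>) \<le> residual_norm x h g \<phi> \<psi>"
  by (simp_all add: residual_norm_def)

lemma norm_char_op_residual_le:
  assumes dom: "frakA_domain x h g \<phi> \<psi>"
  shows "norm (sm lam x - char_op x) \<le>
    (1 + (1 + total_variation \<mu> (- r) 0) * boundary_const lam) * residual_norm x h g \<phi> \<psi>"
proof -
  let ?R = "residual_norm x h g \<phi> \<psi>" and ?V = "total_variation \<mu> (- r) 0"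
  have "norm (sm lam x - char_op x) \<le>
      norm (head_residual x h \<phi>) + norm (sm lam x - char_op x - head_residual x h \<phi>)"
    by (metis add.commute norm_triangle_sub)
  also have "\<dots> \<le> ?R + (boundary_const lam * ?R + ?V * (boundary_const lam * ?R))"
    by (intro add_mono order_trans[OF char_op_estimate[OF dom]] mult_left_mono residuals_le_residual_norm
        boundary_const_nonneg Re_lam_pos total_variation_nonneg[OF mu_bv])
  finally show ?thesis
    by (simp add: algebra_simps)
qed

lemma norm_history_le:
  assumes dom: "frakA_domain x h g \<phi> \<psi>" and \<theta>: "\<theta> \<in> {- r..0}"
  shows "norm (\<phi> \<theta>) \<le> norm x + boundary_const lam * residual_norm x h g \<phi> \<psi>"
proof -
  have "norm (\<phi> \<theta> - exp_fun sm lam x \<theta>) \<le> boundary_const lam * Lp_norm p {- r..0} (history_residual \<phi> \<psi>)"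
    using history_estimate[of \<phi> \<psi>] dom \<theta> by (auto simp: frakA_domain_def)
  also have "\<dots> \<le> boundary_const lam * residual_norm x h g \<phi> \<psi>"
    by (intro mult_left_mono residuals_le_residual_norm boundary_const_nonneg Re_lam_pos)
  finally show ?thesis
    using norm_exp_fun_le[of lam \<theta> x] Re_lam_pos \<theta> norm_triangle_sub[of "\<phi> \<theta>" "exp_fun sm lam x \<theta>"] by simp
qed

lemma norm_delay_op_history_le:
  assumes dom: "frakA_domain x h g \<phi> \<psi>"
  shows "norm (delay_op \<mu> r \<phi>) \<le>
    total_variation \<mu> (- r) 0 * (norm x + boundary_const lam * residual_norm x h g \<phi> \<psi>)"
proof (rule norm_delay_op_le[OF r_nonneg mu_bv _ norm_history_le[OF dom]])
  show "continuous_on {- r..0} \<phi>"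
    using dom by (intro W1p_continuous_on_Icc[of p "- r" _ \<phi> \<psi>]) (auto simp: frakA_domain_def)
qed

lemma Lp_norm_history_le:
  assumes dom: "frakA_domain x h g \<phi> \<psi>"
  shows "Lp_norm p {- r..0} \<phi> \<le>
    r powr (1 / p) * (norm x + boundary_const lam * residual_norm x h g \<phi> \<psi>)"
  using Lp_norm_Icc_le[of p "- r" 0 \<phi>, OF _ _ _ norm_history_le[OF dom]] dom p_ge_1 r_nonneg
  by (simp add: frakA_domain_def W1p_def)

lemma frakA_L_bounded_below:
  assumes delta: "in_resolvent_X0 sm p (A_delta0 sm p D A a) lam"
    and bounded_below: "\<And>x. x \<in> D \<Longrightarrow> norm x \<le> C * norm (sm lam x - char_op x)" and C: "0 \<le> C"
  obtains M where "\<And>x h g \<phi> \<psi>. frakA_domain x h g \<phi> \<psi> \<Longrightarrow>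
    norm x + Lp_norm p {0..} h + Lp_norm p {- r..0} \<phi> \<le> M * residual_norm x h g \<phi> \<psi>"
proof -
  obtain C\<^sub>\<delta> where C\<^sub>\<delta>: "0 \<le> C\<^sub>\<delta>" and memory: "\<And>x h g. x \<in> D \<Longrightarrow> W1p p 0 {0..} h g \<Longrightarrow>
      Lp_norm p {0..} h \<le>
        C\<^sub>\<delta> * (norm (sm lam x - (A x + h 0)) + Lp_norm p {0..} (memory_residual x h g))"
    using A_delta0_memory_bound[OF delta] by blast
  define V where "V = total_variation \<mu> (- r) 0"
  define E where "E = C * (1 + (1 + V) * boundary_const lam)"
  define B where "B = E + boundary_const lam"
  have "norm x + Lp_norm p {0..} h + Lp_norm p {- r..0} \<phi> \<le>
      (E + C\<^sub>\<delta> * (2 + V * B) + r powr (1 / p) * B) * residual_norm x h g \<phi> \<psi>"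
    if dom: "frakA_domain x h g \<phi> \<psi>" for x h g \<phi> \<psi>
  proof -
    let ?R = "residual_norm x h g \<phi> \<psi>"
    have x: "x \<in> D" and W: "W1p p 0 {0..} h g"
      using dom by (auto simp: frakA_domain_def)
    have "norm x \<le> C * ((1 + (1 + V) * boundary_const lam) * ?R)"
      unfolding V_def using bounded_below[OF x] norm_char_op_residual_le[OF dom] C
      by (meson mult_left_mono order_trans)
    then have norm_x: "norm x \<le> E * ?R"
      by (simp add: E_def mult.assoc)
    then have B: "norm x + boundary_const lam * ?R \<le> B * ?R"
      by (simp add: B_def distrib_right)
    have "norm (delay_op \<mu> r \<phi>) \<le> V * (B * ?R)"
      unfolding V_def
      by (intro order_trans[OF norm_delay_op_history_le[OF dom]] mult_left_mono B
          total_variation_nonneg[OF mu_bv])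
    moreover have "sm lam x - (A x + h 0) = head_residual x h \<phi> + delay_op \<mu> r \<phi>"
      by (simp add: head_residual_def)
    ultimately have "norm (sm lam x - (A x + h 0)) \<le> ?R + V * (B * ?R)"
      using norm_triangle_mono[OF residuals_le_residual_norm(1)] by simp
    then have "Lp_norm p {0..} h \<le> C\<^sub>\<delta> * ((?R + V * (B * ?R)) + ?R)"
      using C\<^sub>\<delta> by (intro order_trans[OF memory[OF x W]] mult_left_mono add_mono residuals_le_residual_norm)
    moreover have "Lp_norm p {- r..0} \<phi> \<le> r powr (1 / p) * (B * ?R)"
      by (intro order_trans[OF Lp_norm_history_le[OF dom]] mult_left_mono B) simp
    ultimately show ?thesis
      using norm_x by (simp add: algebra_simps)
  qed
  then show ?thesis
    by (rule that)
qed

lemma in_resolvent_XX_frakA_LI: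
  assumes zero: "in_resolvent_X0 sm p (A_zero p D A) lam"
    and delta: "in_resolvent_X0 sm p (A_delta0 sm p D A a) lam"
    and char: "in_resolvent_X sm D char_op lam"
  shows "in_resolvent_XX sm p r (frakA_L sm p r D A a \<mu>) lam"
proof -
  have surj: "\<exists>x\<in>D. sm lam x - char_op x = y" for y
    using char by (simp add: in_resolvent_X_def)
  obtain C where "\<And>x. x \<in> D \<Longrightarrow> norm x \<le> C * norm (sm lam x - char_op x)"
    using char unfolding in_resolvent_X_def by blast
  then have "norm x \<le> \<bar>C\<bar> * norm (sm lam x - char_op x)" if "x \<in> D" for x
    using that by (meson abs_ge_self mult_right_mono norm_ge_zero order_trans)
  then obtain M where "\<And>x h g \<phi> \<psi>. frakA_domain x h g \<phi> \<psi> \<Longrightarrow>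
      norm x + Lp_norm p {0..} h + Lp_norm p {- r..0} \<phi> \<le> M * residual_norm x h g \<phi> \<psi>"
    using frakA_L_bounded_below[OF delta _ abs_ge_zero] by blast
  moreover have "\<exists>x h g \<phi> \<psi>. frakA_domain x h g \<phi> \<psi> \<and> head_residual x h \<phi> = y \<and>
        Lp_norm p {0..} (\<lambda>t. memory_residual x h g t - f t) = 0 \<and>
        Lp_norm p {- r..0} (\<lambda>t. history_residual \<phi> \<psi> t - \<eta> t) = 0"
    if "Lp p {0..} f" "Lp p {- r..0} \<eta>" for y f \<eta>
    by (rule frakA_L_solve[OF zero surj that]) blast
  ultimately show ?thesis
    unfolding in_resolvent_XX_frakA_L_iff by blast
qed

end

theorem theorem4p2:
  fixes sm :: "complex \<Rightarrow> 'a::banach \<Rightarrow> 'a"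
    and p r :: real
    and D :: "'a set" and A :: "'a \<Rightarrow> 'a"
    and a :: "real \<Rightarrow> complex"
    and \<mu> :: "real \<Rightarrow> 'a \<Rightarrow>\<^sub>L 'a"
    and lam :: complex
  assumes X: "complex_banach_smul sm"
    and p: "1 < p"
    and r: "0 < r"
    and gen: "is_C0_generator sm D A"
    and a_W: "\<exists>a'. W1p p 0 {0..} a a'"
    and mu_lin: "\<forall>\<theta>\<in>{-r..0}. complex_linear sm (blinfun_apply (\<mu> \<theta>))"
    and mu_bv: "bounded_variation_on \<mu> (- r) 0"
    and mu_cont: "continuous (at 0 within {-r..0}) \<mu>"
    and mu_var: "((\<lambda>\<epsilon>. total_variation \<mu> (- \<epsilon>) 0) \<longlongrightarrow> 0) (at_right 0)"
    and lam_pos: "0 < Re lam"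
    and lam_res1: "in_resolvent_X0 sm p (A_delta0 sm p D A a) lam"
    and lam_res2: "in_resolvent_X0 sm p (A_zero p D A) lam"
  shows "in_resolvent_XX sm p r (frakA_L sm p r D A a \<mu>) lam \<longleftrightarrow>
         in_resolvent_X sm D
           (\<lambda>x. sm (1 + laplace a lam) (A x) + delay_op \<mu> r (exp_fun sm lam x)) lam"
proof -
  obtain a' where a': "W1p p 0 {0..} a a'"
    using a_W by blast
  interpret volterra_delay_equation sm p r D A a \<mu> lam
  proof
    show "continuous_on {0..} a"
      by (rule W1p_continuous_on_atLeast[OF a'])
    show "Lp p {0..} a"
      using a' by (simp add: W1p_def)
  qed (use X p r lam_pos mu_bv in auto)
  have "in_resolvent_XX sm p r (frakA_L sm p r D A a \<mu>) lam \<longleftrightarrow> in_resolvent_X sm D char_op lam"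
    using in_resolvent_X_char_opI[OF lam_res2] in_resolvent_XX_frakA_LI[OF lam_res2 lam_res1] by blast
  then show ?thesis
    by (simp add: char_op_def[abs_def])
qed

end
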